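(* Part I. Let $A=\bigoplus_{g\in G}A_g$ be a $G$-graded quasialgebra with cocycle $\phi$ which is a quasicrossed product of $G$ over $A_e$. For every $g\in G$ fix a unit $\overline{g}$ of $A$ lying in $A_g$, with $\overline{e}=1$. Let $\sigma:G\to \mathrm{Aut}(A_e)$ be given by $\sigma(g)(x)=\overline{g}\,x\,\overline{g}_R^{-1}$ for $x\in A_e$, and let $\alpha:G\times G\to U(A_e)$ be given by $$\alpha(g,h)=(\overline{g}\,\overline{h})(\overline{gh})_R^{-1}=\phi((gh)^{-1},gh,(gh)^{-1})\,(\overline{g}\,\overline{h})(\overline{gh})_L^{-1}\qquad (g,h\in G).$$ Then: (i) $A$ is a strongly graded quasialgebra, and $A_g=A_e\overline{g}=\overline{g}A_e$ for all $g\in G$. (ii) $(G,A_e,\phi,\sigma,\alpha)$ is a quasicrossed system for $G$ over $A_e$ (called a quasicrossed system corresponding to $A$). (iii) $A$ is a free (left or right) $A_e$-module, freely generated by the elements $\overline{g}$, $g\in G$. (iv) For all $g,h\in G$ and $x,y\in A_e$, $$(x\overline{g})(y\overline{h})=x\,\sigma(g)(y)\,\alpha(g,h)\,\overline{gh}.$$ Part II (converse). Let $B$ be any associative algebra and $(G,B,\phi,\sigma,\alpha)$ any quasicrossed system for $G$ over $B$. Let $C$ be the free $B$-module freely generated by symbols $\overline{g}$, $g\in G$, with (biadditive) multiplication given by $$(x\overline{g})(y\overline{h})=x\,\sigma(g)(y)\,\alpha(g,h)\,\overline{gh}\qquad (x,y\in B,\ g,h\in G).$$ Then $C$ is a $G$-graded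 quasialgebra (with cocycle $\phi$ and with $C_g=B\overline{g}$ for all $g\in G$) which is a quasicrossed product of $G$ over $C_e=B$ and which has $(G,B,\phi,\sigma,\alpha)$ as a corresponding quasicrossed system.
   Context: $\mathbb{K}$ is an algebraically closed field of characteristic zero and $G$ is a group (written multiplicatively) with neutral element $e$. Algebras are nonzero $\mathbb{K}$-algebras with identity $1$, not necessarily associative unless stated. A $G$-graded algebra is an algebra $A=\bigoplus_{g\in G}A_g$ (direct sum of vector subspaces) with $A_gA_h\subset A_{gh}$ for all $g,h\in G$, where $A_gA_h$ is the set of finite sums of products $x_gx_h$; the set of $g$ with $A_g\neq 0$ generates $G$. It is strongly graded if $A_gA_h=A_{gh}$ for all $g,h$. A cocycle is a map $\phi:G\times G\times G\to\mathbb{K}^\times$ with $\phi(h,k,l)\phi(g,hk,l)\phi(g,h,k)=\phi(g,h,kl)\phi(gh,k,l)$ and $\phi(g,e,h)=1$ for all $g,h,k,l\in G$. A $G$-graded quasialgebra with cocycle $\phi$ is a $G$-graded algebra $A$ satisfying $(x_gx_h)x_k=\phi(g,h,k)\,x_g(x_hx_k)$ for all $x_g\in A_g$, $x_h\in A_h$, $x_k\in A_k$. Then $1\in A_e$, and $A_e$ is an associative algebra. A unit of $A$ is an element $u$ having a left inverse $u_L^{-1}$ (i.e. $u_L^{-1}u=1$) and a right inverse $u_R^{-1}$ (i.e. $uu_R^{-1}=1$). $U(A)$ is the set of units. For a unit $u\in A_g$, the left and right inverses are unique and lie in $A_{g^{-1}}$. For $x\in A_e$ one has $(\overline{g}x)\overline{g}_R^{-1}=\overline{g}(x\overline{g}_R^{-1})$,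 so $\overline{g}x\overline{g}_R^{-1}$ is unambiguous. $A$ is a quasicrossed product of $G$ over $A_e$ if $U(A)\cap A_g\neq\emptyset$ for every $g\in G$. For an associative algebra $B$, a quasicrossed system for $G$ over $B$ is a tuple $(G,B,\phi,\sigma,\alpha)$ where $\phi$ is a cocycle and $\sigma:G\to\mathrm{Aut}(B)$ and $\alpha:G\times G\to U(B)$ are maps such that for all $g,h,k\in G$, $x\in B$: $\sigma(g)(\sigma(h)(x))=\alpha(g,h)\,\sigma(gh)(x)\,\alpha(g,h)^{-1}$; $\alpha(g,h)\alpha(gh,k)=\phi(g,h,k)\,\sigma(g)(\alpha(h,k))\,\alpha(g,hk)$; and $\alpha(g,e)=\alpha(e,g)=1$. In Part II, $B$ is identified with $B\overline{e}$. *)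

theory Defs
  imports
    "HOL-Algebra.Module"
    "HOL-Algebra.QuotRing"
    "HOL-Algebra.Generated_Groups"
    "HOL-Algebra.Algebraic_Closure"
begin

section \<open>Algebras, not necessarily associative\<close>

definition char_zero :: "('k, 'm) ring_scheme \<Rightarrow> bool" where
  "char_zero K \<longleftrightarrow> (\<forall>n::nat. 0 < n \<longrightarrow> [n] \<cdot>\<^bsub>K\<^esub> \<one>\<^bsub>K\<^esub> \<noteq> \<zero>\<^bsub>K\<^esub>)"

text \<open>The library locale \<open>algebra\<close> demands a commutative and associative multiplication, so only
  its underlying locale \<open>module\<close> is reused; over a field this is a vector space.\<close>

locale unital_algebra = K: field K + vs: module K A
  for K :: "('k, 'm) ring_scheme" and A :: "('k, 'a, 'n) module_scheme" +
  assumes alg_mult_closed: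
      "\<lbrakk>x \<in> carrier A; y \<in> carrier A\<rbrakk> \<Longrightarrow> x \<otimes>\<^bsub>A\<^esub> y \<in> carrier A"
    and alg_l_distr:
      "\<lbrakk>x \<in> carrier A; y \<in> carrier A; z \<in> carrier A\<rbrakk>
        \<Longrightarrow> (x \<oplus>\<^bsub>A\<^esub> y) \<otimes>\<^bsub>A\<^esub> z = x \<otimes>\<^bsub>A\<^esub> z \<oplus>\<^bsub>A\<^esub> y \<otimes>\<^bsub>A\<^esub> z"
    and alg_r_distr:
      "\<lbrakk>x \<in> carrier A; y \<in> carrier A; z \<in> carrier A\<rbrakk>
        \<Longrightarrow> z \<otimes>\<^bsub>A\<^esub> (x \<oplus>\<^bsub>A\<^esub> y) = z \<otimes>\<^bsub>A\<^esub> x \<oplus>\<^bsub>A\<^esub> z \<otimes>\<^bsub>A\<^esub> y"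
    and alg_smult_l:
      "\<lbrakk>c \<in> carrier K; x \<in> carrier A; y \<in> carrier A\<rbrakk>
        \<Longrightarrow> (c \<odot>\<^bsub>A\<^esub> x) \<otimes>\<^bsub>A\<^esub> y = c \<odot>\<^bsub>A\<^esub> (x \<otimes>\<^bsub>A\<^esub> y)"
    and alg_smult_r:
      "\<lbrakk>c \<in> carrier K; x \<in> carrier A; y \<in> carrier A\<rbrakk>
        \<Longrightarrow> x \<otimes>\<^bsub>A\<^esub> (c \<odot>\<^bsub>A\<^esub> y) = c \<odot>\<^bsub>A\<^esub> (x \<otimes>\<^bsub>A\<^esub> y)"
    and alg_one_closed: "\<one>\<^bsub>A\<^esub> \<in> carrier A"
    and alg_l_one: "x \<in> carrier A \<Longrightarrow> \<one>\<^bsub>A\<^esub> \<otimes>\<^bsub>A\<^esub> x = x"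
    and alg_r_one: "x \<in> carrier A \<Longrightarrow> x \<otimes>\<^bsub>A\<^esub> \<one>\<^bsub>A\<^esub> = x"
    and alg_nonzero: "\<one>\<^bsub>A\<^esub> \<noteq> \<zero>\<^bsub>A\<^esub>"

locale assoc_algebra = unital_algebra +
  assumes alg_assoc:
      "\<lbrakk>x \<in> carrier A; y \<in> carrier A; z \<in> carrier A\<rbrakk>
        \<Longrightarrow> (x \<otimes>\<^bsub>A\<^esub> y) \<otimes>\<^bsub>A\<^esub> z = x \<otimes>\<^bsub>A\<^esub> (y \<otimes>\<^bsub>A\<^esub> z)"

definition algebra_iso ::
  "('k, 'm) ring_scheme \<Rightarrow> ('k, 'a, 'n) module_scheme \<Rightarrow> ('k, 'b, 'p) module_scheme \<Rightarrow> ('a \<Rightarrow> 'b) set"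
  where "algebra_iso K A B =
    {f \<in> ring_iso A B. \<forall>c\<in>carrier K. \<forall>x\<in>carrier A. f (c \<odot>\<^bsub>A\<^esub> x) = c \<odot>\<^bsub>B\<^esub> f x}"

text \<open>The one-sided inverses of a unit may differ, so this is weaker than membership in
  \<^const>\<open>Units\<close>; the two coincide when the multiplication is associative.\<close>

definition alg_units :: "('k, 'a, 'n) module_scheme \<Rightarrow> 'a set" where
  "alg_units A = {u \<in> carrier A. (\<exists>v\<in>carrier A. v \<otimes>\<^bsub>A\<^esub> u = \<one>\<^bsub>A\<^esub>) \<and> (\<exists>w\<in>carrier A. u \<otimes>\<^bsub>A\<^esub> w = \<one>\<^bsub>A\<^esub>)}"

text \<open>Meaningful for homogeneous units of a graded quasialgebra, whose one-sided inverses are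
  unique.\<close>

definition left_inv :: "('k, 'a, 'n) module_scheme \<Rightarrow> 'a \<Rightarrow> 'a" where
  "left_inv A u = (THE v. v \<in> carrier A \<and> v \<otimes>\<^bsub>A\<^esub> u = \<one>\<^bsub>A\<^esub>)"

definition right_inv :: "('k, 'a, 'n) module_scheme \<Rightarrow> 'a \<Rightarrow> 'a" where
  "right_inv A u = (THE w. w \<in> carrier A \<and> u \<otimes>\<^bsub>A\<^esub> w = \<one>\<^bsub>A\<^esub>)"


section \<open>Graded quasialgebras\<close>

definition mult_sums :: "('k, 'a, 'n) module_scheme \<Rightarrow> 'a set \<Rightarrow> 'a set \<Rightarrow> 'a set" where
  "mult_sums A S T =
    {\<Oplus>\<^bsub>A\<^esub>i\<in>{..<n}. x i \<otimes>\<^bsub>A\<^esub> y i | (n::nat) x y. x \<in> {..<n} \<rightarrow> S \<and> y \<in> {..<n} \<rightarrow> T}"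

locale graded_algebra = G: group G + unital_algebra K A
  for G :: "('g, 'l) monoid_scheme"
    and K :: "('k, 'm) ring_scheme"
    and A :: "('k, 'a, 'n) module_scheme" +
  fixes Ag :: "'g \<Rightarrow> 'a set"
  assumes comp_subspace: "g \<in> carrier G \<Longrightarrow> submodule (Ag g) K A"
    and direct_sum: "x \<in> carrier A \<Longrightarrow>
      \<exists>!f. f \<in> (\<Pi>\<^sub>E g\<in>carrier G. Ag g) \<and> finite {g \<in> carrier G. f g \<noteq> \<zero>\<^bsub>A\<^esub>} \<and>
           x = (\<Oplus>\<^bsub>A\<^esub>g\<in>{g \<in> carrier G. f g \<noteq> \<zero>\<^bsub>A\<^esub>}. f g)"
    and comp_mult: "\<lbrakk>g \<in> carrier G; h \<in> carrier G\<rbrakk>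
      \<Longrightarrow> mult_sums A (Ag g) (Ag h) \<subseteq> Ag (g \<otimes>\<^bsub>G\<^esub> h)"
    and support_generates: "generate G {g \<in> carrier G. Ag g \<noteq> {\<zero>\<^bsub>A\<^esub>}} = carrier G"

definition strongly_graded ::
  "('g, 'l) monoid_scheme \<Rightarrow> ('k, 'a, 'n) module_scheme \<Rightarrow> ('g \<Rightarrow> 'a set) \<Rightarrow> bool" where
  "strongly_graded G A Ag \<longleftrightarrow>
    (\<forall>g\<in>carrier G. \<forall>h\<in>carrier G. mult_sums A (Ag g) (Ag h) = Ag (g \<otimes>\<^bsub>G\<^esub> h))"

definition cocycle ::
  "('g, 'l) monoid_scheme \<Rightarrow> ('k, 'm) ring_scheme \<Rightarrow> ('g \<Rightarrow> 'g \<Rightarrow> 'g \<Rightarrow> 'k) \<Rightarrow> bool" where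
  "cocycle G K \<phi> \<longleftrightarrow>
    (\<forall>g\<in>carrier G. \<forall>h\<in>carrier G. \<forall>k\<in>carrier G. \<phi> g h k \<in> Units K) \<and>
    (\<forall>g\<in>carrier G. \<forall>h\<in>carrier G. \<forall>k\<in>carrier G. \<forall>l\<in>carrier G.
      \<phi> h k l \<otimes>\<^bsub>K\<^esub> \<phi> g (h \<otimes>\<^bsub>G\<^esub> k) l \<otimes>\<^bsub>K\<^esub> \<phi> g h k
        = \<phi> g h (k \<otimes>\<^bsub>G\<^esub> l) \<otimes>\<^bsub>K\<^esub> \<phi> (g \<otimes>\<^bsub>G\<^esub> h) k l) \<and>
    (\<forall>g\<in>carrier G. \<forall>h\<in>carrier G. \<phi> g \<one>\<^bsub>G\<^esub> h = \<one>\<^bsub>K\<^esub>)"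

locale graded_quasialgebra = graded_algebra +
  fixes \<phi>
  assumes cocycle: "cocycle G K \<phi>"
    and quasi_assoc:
      "\<lbrakk>g \<in> carrier G; h \<in> carrier G; k \<in> carrier G; x \<in> Ag g; y \<in> Ag h; z \<in> Ag k\<rbrakk>
        \<Longrightarrow> (x \<otimes>\<^bsub>A\<^esub> y) \<otimes>\<^bsub>A\<^esub> z = \<phi> g h k \<odot>\<^bsub>A\<^esub> (x \<otimes>\<^bsub>A\<^esub> (y \<otimes>\<^bsub>A\<^esub> z))"

abbreviation neutral_comp ::
  "('g, 'l) monoid_scheme \<Rightarrow> ('k, 'a, 'n) module_scheme \<Rightarrow> ('g \<Rightarrow> 'a set) \<Rightarrow> ('k, 'a, 'n) module_scheme"
  where "neutral_comp G A Ag \<equiv> A\<lparr>carrier := Ag \<one>\<^bsub>G\<^esub>\<rparr>"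

locale quasicrossed_product = graded_quasialgebra +
  assumes homogeneous_unit: "g \<in> carrier G \<Longrightarrow> alg_units A \<inter> Ag g \<noteq> {}"


section \<open>Quasicrossed systems\<close>

locale quasicrossed_system = G: group G + assoc_algebra K B
  for G :: "('g, 'l) monoid_scheme"
    and K :: "('k, 'm) ring_scheme"
    and B :: "('k, 'b, 'n) module_scheme" +
  fixes \<phi> :: "'g \<Rightarrow> 'g \<Rightarrow> 'g \<Rightarrow> 'k"
    and \<sigma> :: "'g \<Rightarrow> 'b \<Rightarrow> 'b"
    and \<alpha> :: "'g \<Rightarrow> 'g \<Rightarrow> 'b"
  assumes cocycle: "cocycle G K \<phi>"
    and sigma_auto: "g \<in> carrier G \<Longrightarrow> \<sigma> g \<in> algebra_iso K B B"
    and alpha_unit: "\<lbrakk>g \<in> carrier G; h \<in> carrier G\<rbrakk> \<Longrightarrow> \<alpha> g h \<in> alg_units B"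
    and sigma_sigma: "\<lbrakk>g \<in> carrier G; h \<in> carrier G; x \<in> carrier B\<rbrakk>
      \<Longrightarrow> \<sigma> g (\<sigma> h x) = \<alpha> g h \<otimes>\<^bsub>B\<^esub> \<sigma> (g \<otimes>\<^bsub>G\<^esub> h) x \<otimes>\<^bsub>B\<^esub> inv\<^bsub>B\<^esub> (\<alpha> g h)"
    and alpha_alpha: "\<lbrakk>g \<in> carrier G; h \<in> carrier G; k \<in> carrier G\<rbrakk>
      \<Longrightarrow> \<alpha> g h \<otimes>\<^bsub>B\<^esub> \<alpha> (g \<otimes>\<^bsub>G\<^esub> h) k
        = \<phi> g h k \<odot>\<^bsub>B\<^esub> (\<sigma> g (\<alpha> h k) \<otimes>\<^bsub>B\<^esub> \<alpha> g (h \<otimes>\<^bsub>G\<^esub> k))"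
    and alpha_one: "g \<in> carrier G \<Longrightarrow> \<alpha> g \<one>\<^bsub>G\<^esub> = \<one>\<^bsub>B\<^esub> \<and> \<alpha> \<one>\<^bsub>G\<^esub> g = \<one>\<^bsub>B\<^esub>"

text \<open>The element \<open>u g\<close> is the chosen homogeneous unit of degree \<open>g\<close>.\<close>

definition unit_choice ::
  "('g, 'l) monoid_scheme \<Rightarrow> ('k, 'a, 'n) module_scheme \<Rightarrow> ('g \<Rightarrow> 'a set) \<Rightarrow> ('g \<Rightarrow> 'a) \<Rightarrow> bool" where
  "unit_choice G A Ag u \<longleftrightarrow>
    (\<forall>g\<in>carrier G. u g \<in> alg_units A \<inter> Ag g) \<and> u \<one>\<^bsub>G\<^esub> = \<one>\<^bsub>A\<^esub>"

definition corresponds_to_choice ::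
  "('g, 'l) monoid_scheme \<Rightarrow> ('k, 'a, 'n) module_scheme \<Rightarrow> ('g \<Rightarrow> 'a set) \<Rightarrow> ('g \<Rightarrow> 'a)
    \<Rightarrow> ('g \<Rightarrow> 'a \<Rightarrow> 'a) \<Rightarrow> ('g \<Rightarrow> 'g \<Rightarrow> 'a) \<Rightarrow> bool" where
  "corresponds_to_choice G A Ag u \<sigma> \<alpha> \<longleftrightarrow>
    unit_choice G A Ag u \<and>
    (\<forall>g\<in>carrier G. \<forall>x\<in>Ag \<one>\<^bsub>G\<^esub>. \<sigma> g x = (u g \<otimes>\<^bsub>A\<^esub> x) \<otimes>\<^bsub>A\<^esub> right_inv A (u g)) \<and>
    (\<forall>g\<in>carrier G. \<forall>h\<in>carrier G.
      \<alpha> g h = (u g \<otimes>\<^bsub>A\<^esub> u h) \<otimes>\<^bsub>A\<^esub> right_inv A (u (g \<otimes>\<^bsub>G\<^esub> h)))"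


section \<open>Free modules over noncommutative rings\<close>

locale left_module = R: ring R + M: abelian_group M
  for R :: "('r, 'p) ring_scheme" and M :: "('x, 'q) ring_scheme" +
  fixes act :: "'r \<Rightarrow> 'x \<Rightarrow> 'x"
  assumes act_closed: "\<lbrakk>r \<in> carrier R; m \<in> carrier M\<rbrakk> \<Longrightarrow> act r m \<in> carrier M"
    and act_l_distr: "\<lbrakk>r \<in> carrier R; s \<in> carrier R; m \<in> carrier M\<rbrakk>
      \<Longrightarrow> act (r \<oplus>\<^bsub>R\<^esub> s) m = act r m \<oplus>\<^bsub>M\<^esub> act s m"
    and act_r_distr: "\<lbrakk>r \<in> carrier R; m \<in> carrier M; m' \<in> carrier M\<rbrakk>
      \<Longrightarrow> act r (m \<oplus>\<^bsub>M\<^esub> m') = act r m \<oplus>\<^bsub>M\<^esub> act r m'"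
    and act_mult: "\<lbrakk>r \<in> carrier R; s \<in> carrier R; m \<in> carrier M\<rbrakk>
      \<Longrightarrow> act (r \<otimes>\<^bsub>R\<^esub> s) m = act r (act s m)"
    and act_one: "m \<in> carrier M \<Longrightarrow> act \<one>\<^bsub>R\<^esub> m = m"

locale right_module = R: ring R + M: abelian_group M
  for R :: "('r, 'p) ring_scheme" and M :: "('x, 'q) ring_scheme" +
  fixes act :: "'x \<Rightarrow> 'r \<Rightarrow> 'x"
  assumes act_closed: "\<lbrakk>r \<in> carrier R; m \<in> carrier M\<rbrakk> \<Longrightarrow> act m r \<in> carrier M"
    and act_r_distr: "\<lbrakk>r \<in> carrier R; s \<in> carrier R; m \<in> carrier M\<rbrakk>
      \<Longrightarrow> act m (r \<oplus>\<^bsub>R\<^esub> s) = act m r \<oplus>\<^bsub>M\<^esub> act m s"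
    and act_l_distr: "\<lbrakk>r \<in> carrier R; m \<in> carrier M; m' \<in> carrier M\<rbrakk>
      \<Longrightarrow> act (m \<oplus>\<^bsub>M\<^esub> m') r = act m r \<oplus>\<^bsub>M\<^esub> act m' r"
    and act_mult: "\<lbrakk>r \<in> carrier R; s \<in> carrier R; m \<in> carrier M\<rbrakk>
      \<Longrightarrow> act m (r \<otimes>\<^bsub>R\<^esub> s) = act (act m r) s"
    and act_one: "m \<in> carrier M \<Longrightarrow> act m \<one>\<^bsub>R\<^esub> = m"

locale free_left_module = left_module +
  fixes I :: "'i set" and b
  assumes generators_closed: "i \<in> I \<Longrightarrow> b i \<in> carrier M"
    and unique_expansion: "m \<in> carrier M \<Longrightarrow>
      \<exists>!f. f \<in> I \<rightarrow>\<^sub>E carrier R \<and> finite {i \<in> I. f i \<noteq> \<zero>\<^bsub>R\<^esub>} \<and>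
           m = (\<Oplus>\<^bsub>M\<^esub>i\<in>{i \<in> I. f i \<noteq> \<zero>\<^bsub>R\<^esub>}. act (f i) (b i))"

locale free_right_module = right_module +
  fixes I :: "'i set" and b
  assumes generators_closed: "i \<in> I \<Longrightarrow> b i \<in> carrier M"
    and unique_expansion: "m \<in> carrier M \<Longrightarrow>
      \<exists>!f. f \<in> I \<rightarrow>\<^sub>E carrier R \<and> finite {i \<in> I. f i \<noteq> \<zero>\<^bsub>R\<^esub>} \<and>
           m = (\<Oplus>\<^bsub>M\<^esub>i\<in>{i \<in> I. f i \<noteq> \<zero>\<^bsub>R\<^esub>}. act (b i) (f i))"


section \<open>The algebra of a quasicrossed system\<close>

text \<open>The formal sum of the \<open>x\<^sub>g g\<close> with \<open>x\<^sub>g\<close> in \<open>B\<close> is the finitely supported function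
  \<open>g \<mapsto> x\<^sub>g\<close>, set to zero outside \<open>carrier G\<close>; \<open>fmonom B x g\<close> is \<open>x g\<close>, so the symbol \<open>g\<close> is
  \<open>fmonom B \<one>\<^bsub>B\<^esub> g\<close>.\<close>

definition fmonom :: "('k, 'b, 'n) module_scheme \<Rightarrow> 'b \<Rightarrow> 'g \<Rightarrow> 'g \<Rightarrow> 'b" where
  "fmonom B x g = (\<lambda>h. if h = g then x else \<zero>\<^bsub>B\<^esub>)"

text \<open>The multiplication is the biadditive extension of
  \<open>(x g) (y h) = (x \<sigma>(g)(y) \<alpha>(g,h)) gh\<close>, read off at the generator \<open>k\<close>.\<close>

definition quasicrossed_algebra ::
  "('g, 'l) monoid_scheme \<Rightarrow> ('k, 'b, 'n) module_scheme \<Rightarrow> ('g \<Rightarrow> 'b \<Rightarrow> 'b) \<Rightarrow> ('g \<Rightarrow> 'g \<Rightarrow> 'b)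
    \<Rightarrow> ('k, 'g \<Rightarrow> 'b) module" where
  "quasicrossed_algebra G B \<sigma> \<alpha> =
    \<lparr>partial_object.carrier = {f. f \<in> carrier G \<rightarrow> carrier B \<and> (\<forall>g. g \<notin> carrier G \<longrightarrow> f g = \<zero>\<^bsub>B\<^esub>) \<and>
                   finite {g. f g \<noteq> \<zero>\<^bsub>B\<^esub>}},
     monoid.mult = (\<lambda>p q k. \<Oplus>\<^bsub>B\<^esub>gh\<in>{(g, h). p g \<noteq> \<zero>\<^bsub>B\<^esub> \<and> q h \<noteq> \<zero>\<^bsub>B\<^esub> \<and> g \<otimes>\<^bsub>G\<^esub> h = k}.
               p (fst gh) \<otimes>\<^bsub>B\<^esub> \<sigma> (fst gh) (q (snd gh)) \<otimes>\<^bsub>B\<^esub> \<alpha> (fst gh) (snd gh)),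
     monoid.one = fmonom B \<one>\<^bsub>B\<^esub> \<one>\<^bsub>G\<^esub>,
     ring.zero = (\<lambda>g. \<zero>\<^bsub>B\<^esub>),
     ring.add = (\<lambda>p q g. p g \<oplus>\<^bsub>B\<^esub> q g),
     module.smult = (\<lambda>c p g. c \<odot>\<^bsub>B\<^esub> p g)\<rparr>"

definition coeff_act :: "('k, 'b, 'n) module_scheme \<Rightarrow> 'b \<Rightarrow> ('g \<Rightarrow> 'b) \<Rightarrow> 'g \<Rightarrow> 'b" where
  "coeff_act B x p = (\<lambda>g. x \<otimes>\<^bsub>B\<^esub> p g)"

definition fmonom_comp :: "('k, 'b, 'n) module_scheme \<Rightarrow> 'g \<Rightarrow> ('g \<Rightarrow> 'b) set" where
  "fmonom_comp B g = {fmonom B x g | x. x \<in> carrier B}"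

end

theory Submission
  imports Defs
begin

text \<open>Write \<open>u g\<close> for the chosen unit of degree \<open>g\<close>. Every associativity factor with a neutral
  argument is \<open>1\<close>, so products may be rebracketed freely as soon as one factor lies in \<open>A\<^sub>e\<close>, and
  right multiplication by \<open>u g\<close> is a bijection from \<open>A\<^sub>e\<close> onto \<open>A\<^sub>g\<close>. Hence \<open>\<sigma>(g)(x)\<close> and \<open>\<alpha>(g,h)\<close>
  are the unique elements of \<open>A\<^sub>e\<close> with \<open>\<sigma>(g)(x) u g = u g x\<close> and \<open>\<alpha>(g,h) u (gh) = u g u h\<close>, and each
  identity of Part I follows by comparing two elements after multiplying them by some \<open>u g\<close>.
  In Part II the quasi-associativity needs checking on monomials only, and the same characterisation
  of \<open>\<sigma>\<close> and \<open>\<alpha>\<close> shows that the given system corresponds to the units \<open>1 g\<close>; Part I then makes its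
  transport along \<open>B \<rightarrow> B e\<close> a quasicrossed system.\<close>

section \<open>Homogeneous components\<close>

text \<open>The grading supplies nothing but projections onto the components: neither
  \<open>1\<close> nor the one-sided inverses of a unit are assumed homogeneous. Multiplication by a
  homogeneous element shifts degrees injectively and therefore commutes with the projections.
  Projecting an equation such as a w = 1 to degree e then yields homogeneous inverses, and the same
  device carries cancellation and the module laws over \<open>A\<^sub>e\<close> from homogeneous to
  arbitrary elements.

  The obstacle is that the left inverse v and the right inverse w of a unit a of degree g may
  differ. Rebracketing (v a) w shows that w is \<phi>(g^-1,g,g^-1) times v, which is the constant in
  the second formula for \<alpha>. As \<sigma> and \<alpha> are defined through w, their
  characterisations require (x w) a = x for x of degree g. Rebracketing there costs
  \<phi>(g,g^-1,g), replacing w by v costs \<phi>(g^-1,g,g^-1), and the cocycle identity makes these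
  two scalars reciprocal. This is why the characterisations carry no scalar at all.\<close>

context unital_algebra
begin

lemma zero_mult: "y \<in> carrier A \<Longrightarrow> \<zero>\<^bsub>A\<^esub> \<otimes>\<^bsub>A\<^esub> y = \<zero>\<^bsub>A\<^esub>"
  using alg_l_distr[of "\<zero>\<^bsub>A\<^esub>" "\<zero>\<^bsub>A\<^esub>" y] alg_mult_closed[of "\<zero>\<^bsub>A\<^esub>" y] by simp

lemma mult_zero: "y \<in> carrier A \<Longrightarrow> y \<otimes>\<^bsub>A\<^esub> \<zero>\<^bsub>A\<^esub> = \<zero>\<^bsub>A\<^esub>"
  using alg_r_distr[of "\<zero>\<^bsub>A\<^esub>" "\<zero>\<^bsub>A\<^esub>" y] alg_mult_closed[of y "\<zero>\<^bsub>A\<^esub>"] by simp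

lemma smult_Units_cancel:
  assumes "c \<in> Units K" "x \<in> carrier A" "y \<in> carrier A" "c \<odot>\<^bsub>A\<^esub> x = c \<odot>\<^bsub>A\<^esub> y"
  shows "x = y"
proof -
  have "inv\<^bsub>K\<^esub> c \<odot>\<^bsub>A\<^esub> (c \<odot>\<^bsub>A\<^esub> z) = z" if "z \<in> carrier A" for z
    using vs.smult_assoc1[of "inv\<^bsub>K\<^esub> c" c z] K.Units_inv_closed[OF assms(1)]
      K.Units_closed[OF assms(1)] K.Units_l_inv[OF assms(1)] that by simp
  then show ?thesis
    using assms by metis
qed

end

lemma (in abelian_group) additive_finsum:
  assumes "finite F" "T \<in> carrier G \<rightarrow> carrier G"
    and "\<And>x y. \<lbrakk>x \<in> carrier G; y \<in> carrier G\<rbrakk> \<Longrightarrow> T (x \<oplus> y) = T x \<oplus> T y"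
    and "f \<in> F \<rightarrow> carrier G"
  shows "T (\<Oplus>i\<in>F. f i) = (\<Oplus>i\<in>F. T (f i))"
proof -
  have "T \<zero> \<oplus> T \<zero> = T \<zero>"
    using assms(3)[of \<zero> \<zero>] by simp
  moreover have "T \<zero> \<in> carrier G"
    using assms(2) by auto
  ultimately have T0: "T \<zero> = \<zero>"
    by simp
  show ?thesis
    using assms(1,4)
  proof (induction F)
    case empty
    then show ?case by (simp add: T0)
  next
    case (insert a F)
    have "T (\<Oplus>i\<in>insert a F. f i) = T (f a \<oplus> (\<Oplus>i\<in>F. f i))"
      using insert by (subst finsum_insert) auto
    also have "\<dots> = T (f a) \<oplus> T (\<Oplus>i\<in>F. f i)"
      using insert by (intro assms(3) finsum_closed) auto
    also have "\<dots> = (\<Oplus>i\<in>insert a F. T (f i))"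
      using insert assms(2) by (subst finsum_insert) (auto simp: Pi_iff)
    finally show ?case .
  qed
qed

section \<open>Projections onto the homogeneous components\<close>

context graded_algebra
begin

definition component :: "'a \<Rightarrow> 'g \<Rightarrow> 'a" where
  "component x = (THE f. f \<in> (\<Pi>\<^sub>E g\<in>carrier G. Ag g) \<and> finite {g \<in> carrier G. f g \<noteq> \<zero>\<^bsub>A\<^esub>} \<and>
           x = (\<Oplus>\<^bsub>A\<^esub>g\<in>{g \<in> carrier G. f g \<noteq> \<zero>\<^bsub>A\<^esub>}. f g))"

lemma Ag_carrier: "\<lbrakk>g \<in> carrier G; x \<in> Ag g\<rbrakk> \<Longrightarrow> x \<in> carrier A"
  using vs.submoduleE(1)[OF comp_subspace] by blast

lemma Ag_zero: "g \<in> carrier G \<Longrightarrow> \<zero>\<^bsub>A\<^esub> \<in> Ag g"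
  using subgroup.one_closed[OF submodule.axioms(1)[OF comp_subspace]] by simp

lemma Ag_smult: "\<lbrakk>g \<in> carrier G; c \<in> carrier K; x \<in> Ag g\<rbrakk> \<Longrightarrow> c \<odot>\<^bsub>A\<^esub> x \<in> Ag g"
  using vs.submoduleE(4)[OF comp_subspace] by blast

lemma Ag_add: "\<lbrakk>g \<in> carrier G; x \<in> Ag g; y \<in> Ag g\<rbrakk> \<Longrightarrow> x \<oplus>\<^bsub>A\<^esub> y \<in> Ag g"
  using vs.submoduleE(5)[OF comp_subspace] by blast

lemma mult_in_mult_sums:
  assumes "x \<in> S" "y \<in> T" "x \<otimes>\<^bsub>A\<^esub> y \<in> carrier A"
  shows "x \<otimes>\<^bsub>A\<^esub> y \<in> mult_sums A S T"
proof -
  have "{..<Suc 0} = {0}" by auto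
  then have "x \<otimes>\<^bsub>A\<^esub> y = (\<Oplus>\<^bsub>A\<^esub>i\<in>{..<Suc 0}. (\<lambda>_. x) i \<otimes>\<^bsub>A\<^esub> (\<lambda>_. y) i)"
    using assms by simp
  then show ?thesis
    unfolding mult_sums_def using assms by (intro CollectI exI[of _ "Suc 0"] exI conjI) auto
qed

lemma Ag_mult:
  assumes "g \<in> carrier G" "h \<in> carrier G" "x \<in> Ag g" "y \<in> Ag h"
  shows "x \<otimes>\<^bsub>A\<^esub> y \<in> Ag (g \<otimes>\<^bsub>G\<^esub> h)"
  using comp_mult[OF assms(1,2)] mult_in_mult_sums[OF assms(3,4)] assms Ag_carrier alg_mult_closed
  by blast

lemma component_props:
  assumes "x \<in> carrier A"
  shows "component x \<in> (\<Pi>\<^sub>E g\<in>carrier G. Ag g)"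
    and "finite {g \<in> carrier G. component x g \<noteq> \<zero>\<^bsub>A\<^esub>}"
    and "x = (\<Oplus>\<^bsub>A\<^esub>g\<in>{g \<in> carrier G. component x g \<noteq> \<zero>\<^bsub>A\<^esub>}. component x g)"
  using theI'[OF direct_sum[OF assms], folded component_def] by blast+

lemma component_in: "\<lbrakk>x \<in> carrier A; g \<in> carrier G\<rbrakk> \<Longrightarrow> component x g \<in> Ag g"
  using component_props(1) by (auto simp: PiE_iff)

text \<open>Any finite index set containing the relevant degrees is allowed, so that applications
  need not know which terms vanish.\<close>

lemma component_unique:
  assumes "finite F" "F \<subseteq> carrier G" "\<And>g. g \<in> F \<Longrightarrow> f g \<in> Ag g"
    and x: "x = (\<Oplus>\<^bsub>A\<^esub>g\<in>F. f g)" and "g \<in> carrier G"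
  shows "component x g = (if g \<in> F then f g else \<zero>\<^bsub>A\<^esub>)"
proof -
  have fA: "f \<in> F \<rightarrow> carrier A"
    using assms Ag_carrier by auto
  then have xA: "x \<in> carrier A"
    using x by simp
  \<comment> \<open>The direct sum axiom speaks of extensional families summed over their exact
    support. Hence \<open>f\<close> is replaced by zero on \<open>carrier G\<close> outside
    \<open>F\<close>, and the vanishing terms are dropped from the sum.\<close>
  define f' where "f' = (\<lambda>g\<in>carrier G. if g \<in> F then f g else \<zero>\<^bsub>A\<^esub>)"
  have sub: "{g \<in> carrier G. f' g \<noteq> \<zero>\<^bsub>A\<^esub>} \<subseteq> F"
    by (auto simp: f'_def split: if_splits)
  have "x = (\<Oplus>\<^bsub>A\<^esub>g\<in>{g \<in> carrier G. f' g \<noteq> \<zero>\<^bsub>A\<^esub>}. f' g)"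
    unfolding x using assms(1,2) sub fA
    by (intro vs.M.add.finprod_mono_neutral_cong_right) (auto simp: f'_def)
  moreover have "f' \<in> (\<Pi>\<^sub>E g\<in>carrier G. Ag g)"
    using assms Ag_zero by (auto simp: f'_def)
  moreover have "finite {g \<in> carrier G. f' g \<noteq> \<zero>\<^bsub>A\<^esub>}"
    using finite_subset[OF sub assms(1)] .
  ultimately have "component x = f'"
    using direct_sum[OF xA] component_props[OF xA] by blast
  then show ?thesis
    using assms(5) by (simp add: f'_def)
qed

lemma component_homogeneous:
  assumes "g \<in> carrier G" "x \<in> Ag g" "h \<in> carrier G"
  shows "component x h = (if h = g then x else \<zero>\<^bsub>A\<^esub>)"
  using component_unique[of "{g}" "\<lambda>_. x" x h] assms Ag_carrier by simp

lemma component_ext: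
  assumes "x \<in> carrier A" "y \<in> carrier A" "\<And>g. g \<in> carrier G \<Longrightarrow> component x g = component y g"
  shows "x = y"
proof -
  have "{g \<in> carrier G. component x g \<noteq> \<zero>\<^bsub>A\<^esub>} = {g \<in> carrier G. component y g \<noteq> \<zero>\<^bsub>A\<^esub>}"
    using assms(3) by auto
  then show ?thesis
    using assms component_props(3)[OF assms(1)] component_props(3)[OF assms(2)]
      component_in[OF assms(2)] Ag_carrier
    by (metis (no_types, lifting) component_props(1) PiE_ext)
qed

text \<open>Applying \<open>T\<close> termwise to the decomposition of \<open>x\<close> gives a
  decomposition of \<open>T x\<close>, since injectivity of \<open>p\<close> keeps images of
  different components in different degrees. The intended \<open>T\<close> is multiplication by a
  homogeneous element and \<open>p\<close> the corresponding translation of the group.\<close>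

lemma component_map:
  assumes T: "T \<in> carrier A \<rightarrow> carrier A"
    and add: "\<And>x y. \<lbrakk>x \<in> carrier A; y \<in> carrier A\<rbrakk> \<Longrightarrow> T (x \<oplus>\<^bsub>A\<^esub> y) = T x \<oplus>\<^bsub>A\<^esub> T y"
    and p: "inj_on p (carrier G)" "p \<in> carrier G \<rightarrow> carrier G"
    and deg: "\<And>g x. \<lbrakk>g \<in> carrier G; x \<in> Ag g\<rbrakk> \<Longrightarrow> T x \<in> Ag (p g)"
    and x: "x \<in> carrier A" and g: "g \<in> carrier G"
  shows "component (T x) (p g) = T (component x g)"
proof -
  \<comment> \<open>The degree \<open>g\<close> is added by hand because the component of
    \<open>x\<close> there may be zero.\<close>
  define F where "F = insert g {g \<in> carrier G. component x g \<noteq> \<zero>\<^bsub>A\<^esub>}"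
  have F: "finite F" "F \<subseteq> carrier G" "g \<in> F"
    using component_props(2)[OF x] g by (auto simp: F_def)
  have cA: "component x \<in> F \<rightarrow> carrier A"
    using component_in[OF x] Ag_carrier F(2) by blast
  have x_sum: "x = (\<Oplus>\<^bsub>A\<^esub>h\<in>F. component x h)"
    by (subst component_props(3)[OF x], rule vs.M.add.finprod_mono_neutral_cong_left)
      (use F cA in \<open>auto simp: F_def\<close>)
  have inj: "inj_on p F"
    using p(1) F(2) inj_on_subset by blast
  \<comment> \<open>The sum has to be indexed by target degrees before the components of
    \<open>T x\<close> can be read off; \<open>q\<close> recovers the source degree.\<close>
  define q where "q = inv_into F p"
  have q: "q (p h) = h" if "h \<in> F" for h
    using inj that by (simp add: q_def)
  have "T x = (\<Oplus>\<^bsub>A\<^esub>h\<in>F. T (component x h))"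
    using vs.M.additive_finsum[OF F(1) T add cA] x_sum by simp
  also have "\<dots> = (\<Oplus>\<^bsub>A\<^esub>h\<in>F. T (component x (q (p h))))"
    using q T cA by (intro vs.M.add.finprod_cong') auto
  also have "\<dots> = (\<Oplus>\<^bsub>A\<^esub>k\<in>p ` F. T (component x (q k)))"
    using q T cA inj by (intro vs.M.finsum_reindex[symmetric]) auto
  finally have "T x = (\<Oplus>\<^bsub>A\<^esub>k\<in>p ` F. T (component x (q k)))" .
  then have "component (T x) (p g) = (if p g \<in> p ` F then T (component x (q (p g))) else \<zero>\<^bsub>A\<^esub>)"
    using F p(2) q g component_in[OF x] deg by (intro component_unique) auto
  then show ?thesis
    using q F(3) by simp
qed

lemma component_mult_right:
  assumes "x \<in> carrier A" "h \<in> carrier G" "y \<in> Ag h" "g \<in> carrier G"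
  shows "component (x \<otimes>\<^bsub>A\<^esub> y) (g \<otimes>\<^bsub>G\<^esub> h) = component x g \<otimes>\<^bsub>A\<^esub> y"
  using assms Ag_carrier[of h y]
  by (intro component_map[where p = "\<lambda>g. g \<otimes>\<^bsub>G\<^esub> h" and T = "\<lambda>x. x \<otimes>\<^bsub>A\<^esub> y"])
    (auto simp: alg_mult_closed alg_l_distr Ag_mult inj_on_def)

lemma component_mult_left:
  assumes "x \<in> carrier A" "h \<in> carrier G" "y \<in> Ag h" "g \<in> carrier G"
  shows "component (y \<otimes>\<^bsub>A\<^esub> x) (h \<otimes>\<^bsub>G\<^esub> g) = y \<otimes>\<^bsub>A\<^esub> component x g"
  using assms Ag_carrier[of h y]
  by (intro component_map[where p = "\<lambda>g. h \<otimes>\<^bsub>G\<^esub> g" and T = "\<lambda>x. y \<otimes>\<^bsub>A\<^esub> x"])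
    (auto simp: alg_mult_closed alg_r_distr Ag_mult inj_on_def)

text \<open>The degree \<open>e\<close> component of \<open>1\<close> is a left identity on homogeneous elements, hence on all
  of \<open>A\<close>, hence equal to \<open>1\<close>.\<close>

lemma one_homogeneous: "\<one>\<^bsub>A\<^esub> \<in> Ag \<one>\<^bsub>G\<^esub>"
proof -
  define e where "e = component \<one>\<^bsub>A\<^esub> \<one>\<^bsub>G\<^esub>"
  have e: "e \<in> Ag \<one>\<^bsub>G\<^esub>"
    using component_in[OF alg_one_closed] by (simp add: e_def)
  have eh: "e \<otimes>\<^bsub>A\<^esub> y = y" if "h \<in> carrier G" "y \<in> Ag h" for h y
    using component_mult_right[OF alg_one_closed that, of "\<one>\<^bsub>G\<^esub>"] that
    by (simp add: e_def alg_l_one[OF Ag_carrier] component_homogeneous)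
  have "component (e \<otimes>\<^bsub>A\<^esub> \<one>\<^bsub>A\<^esub>) g = component \<one>\<^bsub>A\<^esub> g" if "g \<in> carrier G" for g
    using component_mult_left[OF alg_one_closed G.one_closed e that] that
      eh[OF that component_in[OF alg_one_closed that]] by simp
  then have "e \<otimes>\<^bsub>A\<^esub> \<one>\<^bsub>A\<^esub> = \<one>\<^bsub>A\<^esub>"
    using component_ext[OF alg_mult_closed[OF Ag_carrier[OF G.one_closed e] alg_one_closed]
        alg_one_closed] by blast
  then have "e = \<one>\<^bsub>A\<^esub>"
    using alg_r_one[OF Ag_carrier[OF G.one_closed e]] by simp
  then show ?thesis
    using e by simp
qed

end

section \<open>Homogeneous units\<close>

context graded_quasialgebra
begin

lemma phi_Units: "\<lbrakk>g \<in> carrier G; h \<in> carrier G; k \<in> carrier G\<rbrakk> \<Longrightarrow> \<phi> g h k \<in> Units K"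
  using cocycle by (simp add: cocycle_def)

lemma phi_closed: "\<lbrakk>g \<in> carrier G; h \<in> carrier G; k \<in> carrier G\<rbrakk> \<Longrightarrow> \<phi> g h k \<in> carrier K"
  using phi_Units by (simp add: K.Units_closed)

lemma phi_one_mid: "\<lbrakk>g \<in> carrier G; h \<in> carrier G\<rbrakk> \<Longrightarrow> \<phi> g \<one>\<^bsub>G\<^esub> h = \<one>\<^bsub>K\<^esub>"
  using cocycle by (simp add: cocycle_def)

lemma phi_cocycle:
  "\<lbrakk>g \<in> carrier G; h \<in> carrier G; k \<in> carrier G; l \<in> carrier G\<rbrakk> \<Longrightarrow>
    \<phi> h k l \<otimes>\<^bsub>K\<^esub> \<phi> g (h \<otimes>\<^bsub>G\<^esub> k) l \<otimes>\<^bsub>K\<^esub> \<phi> g h k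
      = \<phi> g h (k \<otimes>\<^bsub>G\<^esub> l) \<otimes>\<^bsub>K\<^esub> \<phi> (g \<otimes>\<^bsub>G\<^esub> h) k l"
  using cocycle by (simp add: cocycle_def)

text \<open>At (g,h,e,e) the cocycle identity collapses to c c = c for the unit c =
  \<phi>(g,h,e).\<close>

lemma phi_one_right:
  assumes "g \<in> carrier G" "h \<in> carrier G"
  shows "\<phi> g h \<one>\<^bsub>G\<^esub> = \<one>\<^bsub>K\<^esub>"
proof -
  have "\<phi> g h \<one>\<^bsub>G\<^esub> \<otimes>\<^bsub>K\<^esub> \<phi> g h \<one>\<^bsub>G\<^esub> = \<phi> g h \<one>\<^bsub>G\<^esub> \<otimes>\<^bsub>K\<^esub> \<one>\<^bsub>K\<^esub>"
    using phi_cocycle[of g h "\<one>\<^bsub>G\<^esub>" "\<one>\<^bsub>G\<^esub>"] assms by (simp add: phi_one_mid phi_closed)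
  then show ?thesis
    using assms phi_Units phi_closed by (simp add: K.Units_l_cancel del: K.r_one)
qed

text \<open>At (e,e,g,h) the cocycle identity collapses to c c = c for the unit c =
  \<phi>(e,g,h).\<close>

lemma phi_one_left:
  assumes "g \<in> carrier G" "h \<in> carrier G"
  shows "\<phi> \<one>\<^bsub>G\<^esub> g h = \<one>\<^bsub>K\<^esub>"
proof -
  have "\<phi> \<one>\<^bsub>G\<^esub> g h \<otimes>\<^bsub>K\<^esub> \<phi> \<one>\<^bsub>G\<^esub> g h = \<phi> \<one>\<^bsub>G\<^esub> g h \<otimes>\<^bsub>K\<^esub> \<one>\<^bsub>K\<^esub>"
    using phi_cocycle[of "\<one>\<^bsub>G\<^esub>" "\<one>\<^bsub>G\<^esub>" g h] assms by (simp add: phi_one_mid phi_closed)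
  then show ?thesis
    using assms phi_Units phi_closed by (simp add: K.Units_l_cancel del: K.r_one)
qed

text \<open>This is the cocycle identity at (g,g^-1,g,g^-1), where the three other factors have a
  neutral argument. It reconciles the left and right inverses of a homogeneous unit.\<close>

lemma phi_inverse:
  assumes "g \<in> carrier G"
  shows "\<phi> (inv\<^bsub>G\<^esub> g) g (inv\<^bsub>G\<^esub> g) \<otimes>\<^bsub>K\<^esub> \<phi> g (inv\<^bsub>G\<^esub> g) g = \<one>\<^bsub>K\<^esub>"
  using phi_cocycle[of g "inv\<^bsub>G\<^esub> g" g "inv\<^bsub>G\<^esub> g"] assms
  by (simp add: phi_one_mid phi_one_left phi_one_right phi_closed)

lemma assoc_neutral:
  assumes "g \<in> carrier G" "h \<in> carrier G" "k \<in> carrier G" "x \<in> Ag g" "y \<in> Ag h" "z \<in> Ag k"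
    and "g = \<one>\<^bsub>G\<^esub> \<or> h = \<one>\<^bsub>G\<^esub> \<or> k = \<one>\<^bsub>G\<^esub>"
  shows "(x \<otimes>\<^bsub>A\<^esub> y) \<otimes>\<^bsub>A\<^esub> z = x \<otimes>\<^bsub>A\<^esub> (y \<otimes>\<^bsub>A\<^esub> z)"
proof -
  have "x \<otimes>\<^bsub>A\<^esub> (y \<otimes>\<^bsub>A\<^esub> z) \<in> carrier A"
    by (intro alg_mult_closed Ag_carrier[OF assms(1,4)] Ag_carrier[OF assms(2,5)]
        Ag_carrier[OF assms(3,6)])
  moreover have "\<phi> g h k = \<one>\<^bsub>K\<^esub>"
    using assms phi_one_left phi_one_mid phi_one_right by auto
  ultimately show ?thesis
    using quasi_assoc[OF assms(1-6)] by simp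
qed

section \<open>Inverses, cancellation and division for one homogeneous unit\<close>

context
  fixes g a
  assumes g: "g \<in> carrier G" and a_unit: "a \<in> alg_units A" and a_deg: "a \<in> Ag g"
begin

text \<open>Left multiplication by \<open>a\<close> raises degrees by \<open>g\<close>, so the
  degree e part of a w = 1 involves only the component of w of degree g^-1. That component is
  already a right inverse, because \<open>1\<close> has degree e.\<close>

lemma ex_right_inverse: "\<exists>w\<in>Ag (inv\<^bsub>G\<^esub> g). a \<otimes>\<^bsub>A\<^esub> w = \<one>\<^bsub>A\<^esub>"
proof -
  obtain w where w: "w \<in> carrier A" "a \<otimes>\<^bsub>A\<^esub> w = \<one>\<^bsub>A\<^esub>"
    using a_unit by (auto simp: alg_units_def)
  have "a \<otimes>\<^bsub>A\<^esub> component w (inv\<^bsub>G\<^esub> g) = \<one>\<^bsub>A\<^esub>"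
    using component_mult_left[OF w(1) g a_deg, of "inv\<^bsub>G\<^esub> g"] g w
    by (simp add: component_homogeneous[OF _ one_homogeneous])
  then show ?thesis
    using component_in[OF w(1)] g by auto
qed

lemma ex_left_inverse: "\<exists>v\<in>Ag (inv\<^bsub>G\<^esub> g). v \<otimes>\<^bsub>A\<^esub> a = \<one>\<^bsub>A\<^esub>"
proof -
  obtain v where v: "v \<in> carrier A" "v \<otimes>\<^bsub>A\<^esub> a = \<one>\<^bsub>A\<^esub>"
    using a_unit by (auto simp: alg_units_def)
  have "component v (inv\<^bsub>G\<^esub> g) \<otimes>\<^bsub>A\<^esub> a = \<one>\<^bsub>A\<^esub>"
    using component_mult_right[OF v(1) g a_deg, of "inv\<^bsub>G\<^esub> g"] g v
    by (simp add: component_homogeneous[OF _ one_homogeneous])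
  then show ?thesis
    using component_in[OF v(1)] g by auto
qed

text \<open>Multiplying by a right inverse returns each component up to a scalar that depends only
  on its degree. The scalar is a unit and is the same for \<open>x\<close> and
  \<open>y\<close>.\<close>

lemma unit_r_cancel:
  assumes x: "x \<in> carrier A" and y: "y \<in> carrier A" and eq: "x \<otimes>\<^bsub>A\<^esub> a = y \<otimes>\<^bsub>A\<^esub> a"
  shows "x = y"
proof (rule component_ext[OF x y])
  fix h assume h: "h \<in> carrier G"
  obtain w where w: "w \<in> Ag (inv\<^bsub>G\<^esub> g)" "a \<otimes>\<^bsub>A\<^esub> w = \<one>\<^bsub>A\<^esub>"
    using ex_right_inverse by blast
  have *: "(component z h \<otimes>\<^bsub>A\<^esub> a) \<otimes>\<^bsub>A\<^esub> w = \<phi> h g (inv\<^bsub>G\<^esub> g) \<odot>\<^bsub>A\<^esub> component z h"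
    if "z \<in> carrier A" for z
    using quasi_assoc[OF h g _ component_in[OF that h] a_deg w(1)] g w(2)
      Ag_carrier[OF h component_in[OF that h]] by (simp add: alg_r_one)
  have "component x h \<otimes>\<^bsub>A\<^esub> a = component y h \<otimes>\<^bsub>A\<^esub> a"
    using component_mult_right[OF x g a_deg h] component_mult_right[OF y g a_deg h] eq by simp
  then have "\<phi> h g (inv\<^bsub>G\<^esub> g) \<odot>\<^bsub>A\<^esub> component x h = \<phi> h g (inv\<^bsub>G\<^esub> g) \<odot>\<^bsub>A\<^esub> component y h"
    using *[OF x] *[OF y] by simp
  then show "component x h = component y h"
    by (rule smult_Units_cancel[OF phi_Units[OF h g G.inv_closed[OF g]]
          Ag_carrier[OF h component_in[OF x h]] Ag_carrier[OF h component_in[OF y h]]])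
qed

text \<open>On this side the scalar multiplies v (a z) rather than z, so each component is recovered
  outright and no scalar has to be cancelled.\<close>

lemma unit_l_cancel:
  assumes x: "x \<in> carrier A" and y: "y \<in> carrier A" and eq: "a \<otimes>\<^bsub>A\<^esub> x = a \<otimes>\<^bsub>A\<^esub> y"
  shows "x = y"
proof (rule component_ext[OF x y])
  fix h assume h: "h \<in> carrier G"
  obtain v where v: "v \<in> Ag (inv\<^bsub>G\<^esub> g)" "v \<otimes>\<^bsub>A\<^esub> a = \<one>\<^bsub>A\<^esub>"
    using ex_left_inverse by blast
  have *: "component z h = \<phi> (inv\<^bsub>G\<^esub> g) g h \<odot>\<^bsub>A\<^esub> (v \<otimes>\<^bsub>A\<^esub> (a \<otimes>\<^bsub>A\<^esub> component z h))"
    if "z \<in> carrier A" for z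
    using quasi_assoc[OF _ g h v(1) a_deg component_in[OF that h]] g v(2)
      Ag_carrier[OF h component_in[OF that h]] by (simp add: alg_l_one)
  have "a \<otimes>\<^bsub>A\<^esub> component x h = a \<otimes>\<^bsub>A\<^esub> component y h"
    using component_mult_left[OF x g a_deg h] component_mult_left[OF y g a_deg h] eq by simp
  then show "component x h = component y h"
    using *[OF x] *[OF y] by simp
qed

text \<open>Left cancellation holds on the whole carrier, so the homogeneous right inverse is the
  only right inverse and the definite description denotes it.\<close>

lemma
  shows right_inv_in: "right_inv A a \<in> Ag (inv\<^bsub>G\<^esub> g)"
    and mult_right_inv: "a \<otimes>\<^bsub>A\<^esub> right_inv A a = \<one>\<^bsub>A\<^esub>"
proof -
  obtain w where w: "w \<in> Ag (inv\<^bsub>G\<^esub> g)" "a \<otimes>\<^bsub>A\<^esub> w = \<one>\<^bsub>A\<^esub>"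
    using ex_right_inverse by blast
  have wA: "w \<in> carrier A"
    using w(1) g Ag_carrier by blast
  have "right_inv A a = w"
    unfolding right_inv_def using w wA unit_l_cancel by (intro the_equality) auto
  then show "right_inv A a \<in> Ag (inv\<^bsub>G\<^esub> g)" "a \<otimes>\<^bsub>A\<^esub> right_inv A a = \<one>\<^bsub>A\<^esub>"
    using w by auto
qed

lemma
  shows left_inv_in: "left_inv A a \<in> Ag (inv\<^bsub>G\<^esub> g)"
    and mult_left_inv: "left_inv A a \<otimes>\<^bsub>A\<^esub> a = \<one>\<^bsub>A\<^esub>"
proof -
  obtain v where v: "v \<in> Ag (inv\<^bsub>G\<^esub> g)" "v \<otimes>\<^bsub>A\<^esub> a = \<one>\<^bsub>A\<^esub>"
    using ex_left_inverse by blast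
  have vA: "v \<in> carrier A"
    using v(1) g Ag_carrier by blast
  have "left_inv A a = v"
    unfolding left_inv_def using v vA unit_r_cancel by (intro the_equality) auto
  then show "left_inv A a \<in> Ag (inv\<^bsub>G\<^esub> g)" "left_inv A a \<otimes>\<^bsub>A\<^esub> a = \<one>\<^bsub>A\<^esub>"
    using v by auto
qed

text \<open>With v and w the left and right inverses, (v a) w equals w, while v (a w) equals v;
  quasi-associativity relates the two bracketings.\<close>

lemma right_inv_eq_left_inv:
  "right_inv A a = \<phi> (inv\<^bsub>G\<^esub> g) g (inv\<^bsub>G\<^esub> g) \<odot>\<^bsub>A\<^esub> left_inv A a"
  using quasi_assoc[OF _ g _ left_inv_in a_deg right_inv_in] g
    Ag_carrier[OF _ left_inv_in] Ag_carrier[OF _ right_inv_in]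
  by (simp add: mult_left_inv mult_right_inv alg_l_one alg_r_one)

text \<open>The first scalar comes from rebracketing, the second from replacing the right inverse by
  the left one, which is what can be cancelled against \<open>a\<close> on this side.\<close>

lemma mult_right_inv_cancel:
  assumes h: "h \<in> carrier G" and x: "x \<in> Ag (h \<otimes>\<^bsub>G\<^esub> g)"
  shows "(x \<otimes>\<^bsub>A\<^esub> right_inv A a) \<otimes>\<^bsub>A\<^esub> a
    = \<phi> (h \<otimes>\<^bsub>G\<^esub> g) (inv\<^bsub>G\<^esub> g) g \<odot>\<^bsub>A\<^esub> (\<phi> (inv\<^bsub>G\<^esub> g) g (inv\<^bsub>G\<^esub> g) \<odot>\<^bsub>A\<^esub> x)"
  using quasi_assoc[OF _ _ g x right_inv_in a_deg] g h Ag_carrier[OF _ x]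
    Ag_carrier[OF _ left_inv_in] Ag_carrier[OF g a_deg]
  by (simp add: right_inv_eq_left_inv phi_closed alg_smult_l alg_smult_r mult_left_inv
      alg_one_closed alg_r_one)

lemma right_division:
  assumes h: "h \<in> carrier G" and x: "x \<in> Ag (h \<otimes>\<^bsub>G\<^esub> g)"
  shows "\<exists>y\<in>Ag h. x = y \<otimes>\<^bsub>A\<^esub> a"
proof -
  \<comment> \<open>With v the left inverse, (x v) a is \<phi>(hg,g^-1,g) times x, so the inverse of
    that scalar corrects the quotient x v.\<close>
  define c where "c = inv\<^bsub>K\<^esub> (\<phi> (h \<otimes>\<^bsub>G\<^esub> g) (inv\<^bsub>G\<^esub> g) g)"
  define y where "y = c \<odot>\<^bsub>A\<^esub> (x \<otimes>\<^bsub>A\<^esub> left_inv A a)"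
  have U: "\<phi> (h \<otimes>\<^bsub>G\<^esub> g) (inv\<^bsub>G\<^esub> g) g \<in> Units K"
    using g h phi_Units by simp
  have xA: "x \<in> carrier A"
    using Ag_carrier[OF _ x] g h by simp
  have "x \<otimes>\<^bsub>A\<^esub> left_inv A a \<in> Ag h"
    using Ag_mult[OF _ _ x left_inv_in] g h by (simp add: G.m_assoc)
  then have "y \<in> Ag h"
    using h U by (simp add: y_def c_def Ag_smult)
  moreover have "y \<otimes>\<^bsub>A\<^esub> a = c \<odot>\<^bsub>A\<^esub> ((x \<otimes>\<^bsub>A\<^esub> left_inv A a) \<otimes>\<^bsub>A\<^esub> a)"
    unfolding y_def c_def using U xA Ag_carrier[OF _ left_inv_in] g Ag_carrier[OF g a_deg]
    by (simp add: alg_smult_l alg_mult_closed)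
  then have "y \<otimes>\<^bsub>A\<^esub> a = x"
    using quasi_assoc[OF _ _ g x left_inv_in a_deg] g h xA U
    by (simp add: mult_left_inv alg_r_one c_def K.Units_closed flip: vs.smult_assoc1)
  ultimately show ?thesis
    by auto
qed

lemma left_division:
  assumes h: "h \<in> carrier G" and x: "x \<in> Ag (g \<otimes>\<^bsub>G\<^esub> h)"
  shows "\<exists>y\<in>Ag h. x = a \<otimes>\<^bsub>A\<^esub> y"
proof -
  \<comment> \<open>With w the right inverse, x = (a w) x is \<phi>(g,g^-1,gh) times a (w x). The
    scalar already stands on the side of the quotient and is used without inversion.\<close>
  define c where "c = \<phi> g (inv\<^bsub>G\<^esub> g) (g \<otimes>\<^bsub>G\<^esub> h)"
  define y where "y = c \<odot>\<^bsub>A\<^esub> (right_inv A a \<otimes>\<^bsub>A\<^esub> x)"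
  have c: "c \<in> carrier K"
    using g h phi_closed by (simp add: c_def)
  have xA: "x \<in> carrier A"
    using Ag_carrier[OF _ x] g h by simp
  have "right_inv A a \<otimes>\<^bsub>A\<^esub> x \<in> Ag h"
    using Ag_mult[OF _ _ right_inv_in x] g h by (simp flip: G.m_assoc)
  then have "y \<in> Ag h"
    using h c by (simp add: y_def Ag_smult)
  moreover have "a \<otimes>\<^bsub>A\<^esub> y = x"
    using quasi_assoc[OF g _ _ a_deg right_inv_in x] g h xA c Ag_carrier[OF g a_deg] Ag_carrier[OF _ right_inv_in]
    by (simp add: y_def alg_smult_r alg_mult_closed mult_right_inv alg_l_one c_def)
  ultimately show ?thesis
    by auto
qed

text \<open>For \<open>x\<close> of the same degree as \<open>a\<close> the two scalars above are
  reciprocal by \<open>phi_inverse\<close>. It yields the defining relations of \<sigma> and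
  \<alpha> against the chosen units.\<close>

lemma neutral_mult_right_inv_cancel:
  assumes x: "x \<in> Ag g"
  shows "(x \<otimes>\<^bsub>A\<^esub> right_inv A a) \<otimes>\<^bsub>A\<^esub> a = x"
  using mult_right_inv_cancel[of "\<one>\<^bsub>G\<^esub>" x] x g phi_inverse[OF g] Ag_carrier[OF g x]
  by (simp add: phi_closed K.m_comm flip: vs.smult_assoc1)

text \<open>As \<open>z\<close> has degree e, z (a w) may be rebracketed freely. This converse
  allows formulas involving the right inverse to be verified without computing that inverse.\<close>

lemma eq_mult_right_inv:
  assumes z: "z \<in> Ag \<one>\<^bsub>G\<^esub>" and eq: "z \<otimes>\<^bsub>A\<^esub> a = x"
  shows "z = x \<otimes>\<^bsub>A\<^esub> right_inv A a"
  using assoc_neutral[OF _ g _ z a_deg right_inv_in] g eq Ag_carrier[OF _ z]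
  by (simp add: mult_right_inv alg_r_one)

end

end

section \<open>The quasicrossed system of a quasicrossed product\<close>

context assoc_algebra
begin

lemma ring_of_algebra: "ring A"
  by (intro ringI vs.M.abelian_group_axioms monoid.intro)
    (auto simp: alg_mult_closed alg_one_closed alg_l_one alg_r_one alg_assoc alg_l_distr alg_r_distr)

lemma alg_units_eq_Units: "alg_units A = Units A"
proof -
  interpret ring A by (rule ring_of_algebra)
  have "u \<in> Units A" if "u \<in> carrier A" "v \<in> carrier A" "w \<in> carrier A"
    "v \<otimes>\<^bsub>A\<^esub> u = \<one>\<^bsub>A\<^esub>" "u \<otimes>\<^bsub>A\<^esub> w = \<one>\<^bsub>A\<^esub>" for u v w
    using that inv_unique[of v u w] by (auto simp: Units_def)
  then show ?thesis
    unfolding alg_units_def by (auto simp: Units_def)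
qed

end

text \<open>Serves both module structures: \<beta> g is right multiplication by the unit of degree g
  for the left module, and left multiplication for the right module. Coefficients correspond to
  homogeneous components through \<beta>.\<close>

lemma (in graded_algebra) unique_expansion_of_bij:
  assumes bij: "\<And>g. g \<in> carrier G \<Longrightarrow> bij_betw (\<beta> g) (Ag \<one>\<^bsub>G\<^esub>) (Ag g)"
    and \<beta>_zero: "\<And>g. g \<in> carrier G \<Longrightarrow> \<beta> g \<zero>\<^bsub>A\<^esub> = \<zero>\<^bsub>A\<^esub>"
    and m: "m \<in> carrier A"
  shows "\<exists>!f. f \<in> carrier G \<rightarrow>\<^sub>E Ag \<one>\<^bsub>G\<^esub> \<and> finite {g \<in> carrier G. f g \<noteq> \<zero>\<^bsub>A\<^esub>} \<and>
    m = (\<Oplus>\<^bsub>A\<^esub>g\<in>{g \<in> carrier G. f g \<noteq> \<zero>\<^bsub>A\<^esub>}. \<beta> g (f g))"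
proof (rule ex_ex1I)
  have ex: "\<exists>x\<in>Ag \<one>\<^bsub>G\<^esub>. \<beta> g x = component m g" if "g \<in> carrier G" for g
    using bij[OF that] component_in[OF m that] by (force simp: bij_betw_def)
  then obtain f where f: "\<And>g. g \<in> carrier G \<Longrightarrow> f g \<in> Ag \<one>\<^bsub>G\<^esub> \<and> \<beta> g (f g) = component m g"
    by metis
  \<comment> \<open>The two sums run over the support of the coefficients and of the components;
    injectivity of \<beta> g makes these supports coincide.\<close>
  have zero_iff: "f g = \<zero>\<^bsub>A\<^esub> \<longleftrightarrow> component m g = \<zero>\<^bsub>A\<^esub>" if "g \<in> carrier G" for g
    using f[OF that] \<beta>_zero[OF that] bij[OF that] Ag_zero[OF G.one_closed]
    by (metis bij_betw_def inj_on_def)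
  let ?f = "\<lambda>g\<in>carrier G. f g"
  have supp: "{g \<in> carrier G. ?f g \<noteq> \<zero>\<^bsub>A\<^esub>} = {g \<in> carrier G. component m g \<noteq> \<zero>\<^bsub>A\<^esub>}"
    using zero_iff by auto
  have "(\<Oplus>\<^bsub>A\<^esub>g\<in>{g \<in> carrier G. component m g \<noteq> \<zero>\<^bsub>A\<^esub>}. \<beta> g (?f g))
      = (\<Oplus>\<^bsub>A\<^esub>g\<in>{g \<in> carrier G. component m g \<noteq> \<zero>\<^bsub>A\<^esub>}. component m g)"
    using f Ag_carrier component_in[OF m] by (intro vs.M.add.finprod_cong') auto
  then have "m = (\<Oplus>\<^bsub>A\<^esub>g\<in>{g \<in> carrier G. ?f g \<noteq> \<zero>\<^bsub>A\<^esub>}. \<beta> g (?f g))"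
    using component_props(3)[OF m] supp by simp
  then show "\<exists>f. f \<in> carrier G \<rightarrow>\<^sub>E Ag \<one>\<^bsub>G\<^esub> \<and> finite {g \<in> carrier G. f g \<noteq> \<zero>\<^bsub>A\<^esub>} \<and>
      m = (\<Oplus>\<^bsub>A\<^esub>g\<in>{g \<in> carrier G. f g \<noteq> \<zero>\<^bsub>A\<^esub>}. \<beta> g (f g))"
    using f supp component_props(2)[OF m] by (intro exI[of _ ?f] conjI) auto
next
  \<comment> \<open>Any expansion is also a homogeneous decomposition of \<open>m\<close>, so its
    terms are forced; injectivity of \<beta> then forces its coefficients.\<close>
  have comp: "component m g = \<beta> g (f g)"
    if f: "f \<in> carrier G \<rightarrow>\<^sub>E Ag \<one>\<^bsub>G\<^esub>" "finite {g \<in> carrier G. f g \<noteq> \<zero>\<^bsub>A\<^esub>}"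
      "m = (\<Oplus>\<^bsub>A\<^esub>g\<in>{g \<in> carrier G. f g \<noteq> \<zero>\<^bsub>A\<^esub>}. \<beta> g (f g))"
      and g: "g \<in> carrier G" for f g
  proof -
    have "\<beta> h (f h) \<in> Ag h" if "h \<in> carrier G" for h
      using bij[OF that] f(1) that by (auto simp: bij_betw_def)
    then show ?thesis
      using component_unique[OF f(2) _ _ f(3) g] g \<beta>_zero[OF g] by (auto split: if_splits)
  qed
  fix f f'
  assume f: "f \<in> carrier G \<rightarrow>\<^sub>E Ag \<one>\<^bsub>G\<^esub> \<and> finite {g \<in> carrier G. f g \<noteq> \<zero>\<^bsub>A\<^esub>} \<and>
      m = (\<Oplus>\<^bsub>A\<^esub>g\<in>{g \<in> carrier G. f g \<noteq> \<zero>\<^bsub>A\<^esub>}. \<beta> g (f g))"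
    and f': "f' \<in> carrier G \<rightarrow>\<^sub>E Ag \<one>\<^bsub>G\<^esub> \<and> finite {g \<in> carrier G. f' g \<noteq> \<zero>\<^bsub>A\<^esub>} \<and>
      m = (\<Oplus>\<^bsub>A\<^esub>g\<in>{g \<in> carrier G. f' g \<noteq> \<zero>\<^bsub>A\<^esub>}. \<beta> g (f' g))"
  have "f g = f' g" if g: "g \<in> carrier G" for g
  proof (rule inj_onD[OF bij_betw_imp_inj_on[OF bij[OF g]]])
    show "\<beta> g (f g) = \<beta> g (f' g)"
      using comp[of f g] comp[of f' g] f f' g by metis
  qed (use f f' g in auto)
  then show "f = f'"
    using PiE_ext[OF conjunct1[OF f] conjunct1[OF f']] by blast
qed

section \<open>Part I for a fixed choice of homogeneous units\<close>

locale chosen_units = quasicrossed_product G K A Ag \<phi>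
  for G :: "('g, 'l) monoid_scheme" and K :: "('k, 'm) ring_scheme"
    and A :: "('k, 'a, 'n) module_scheme" (structure) and Ag \<phi> +
  fixes u \<sigma> \<alpha>
  assumes corr: "corresponds_to_choice G A Ag u \<sigma> \<alpha>"
begin

abbreviation "E \<equiv> neutral_comp G A Ag"
abbreviation "Ae \<equiv> Ag \<one>\<^bsub>G\<^esub>"

lemma u_unit: "g \<in> carrier G \<Longrightarrow> u g \<in> alg_units A"
  and u_in: "g \<in> carrier G \<Longrightarrow> u g \<in> Ag g"
  and u_one: "u \<one>\<^bsub>G\<^esub> = \<one>"
  and sigma_eq: "\<lbrakk>g \<in> carrier G; x \<in> Ae\<rbrakk> \<Longrightarrow> \<sigma> g x = (u g \<otimes> x) \<otimes> right_inv A (u g)"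
  and alpha_eq: "\<lbrakk>g \<in> carrier G; h \<in> carrier G\<rbrakk>
    \<Longrightarrow> \<alpha> g h = (u g \<otimes> u h) \<otimes> right_inv A (u (g \<otimes>\<^bsub>G\<^esub> h))"
  using corr by (auto simp: corresponds_to_choice_def unit_choice_def)

lemma Ae_carrier: "x \<in> Ae \<Longrightarrow> x \<in> carrier A"
  by (rule Ag_carrier[OF G.one_closed])

lemma u_carrier: "g \<in> carrier G \<Longrightarrow> u g \<in> carrier A"
  by (rule Ag_carrier[OF _ u_in])

lemma Ae_mult: "\<lbrakk>x \<in> Ae; y \<in> Ae\<rbrakk> \<Longrightarrow> x \<otimes> y \<in> Ae"
  using Ag_mult[of "\<one>\<^bsub>G\<^esub>" "\<one>\<^bsub>G\<^esub>"] by simp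

lemma Ae_mult_l: "\<lbrakk>g \<in> carrier G; x \<in> Ae; y \<in> Ag g\<rbrakk> \<Longrightarrow> x \<otimes> y \<in> Ag g"
  using Ag_mult[of "\<one>\<^bsub>G\<^esub>" g] by simp

lemma Ae_mult_r: "\<lbrakk>g \<in> carrier G; x \<in> Ag g; y \<in> Ae\<rbrakk> \<Longrightarrow> x \<otimes> y \<in> Ag g"
  using Ag_mult[of g "\<one>\<^bsub>G\<^esub>"] by simp

lemma assoc_l:
  "\<lbrakk>g \<in> carrier G; h \<in> carrier G; x \<in> Ae; y \<in> Ag g; z \<in> Ag h\<rbrakk> \<Longrightarrow> (x \<otimes> y) \<otimes> z = x \<otimes> (y \<otimes> z)"
  using assoc_neutral[of "\<one>\<^bsub>G\<^esub>" g h x y z] by simp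

lemma assoc_m:
  "\<lbrakk>g \<in> carrier G; h \<in> carrier G; x \<in> Ag g; y \<in> Ae; z \<in> Ag h\<rbrakk> \<Longrightarrow> (x \<otimes> y) \<otimes> z = x \<otimes> (y \<otimes> z)"
  using assoc_neutral[of g "\<one>\<^bsub>G\<^esub>" h x y z] by simp

lemma assoc_r:
  "\<lbrakk>g \<in> carrier G; h \<in> carrier G; x \<in> Ag g; y \<in> Ag h; z \<in> Ae\<rbrakk> \<Longrightarrow> (x \<otimes> y) \<otimes> z = x \<otimes> (y \<otimes> z)"
  using assoc_neutral[of g h "\<one>\<^bsub>G\<^esub>" x y z] by simp

lemma u_r_cancel:
  "\<lbrakk>g \<in> carrier G; x \<in> carrier A; y \<in> carrier A; x \<otimes> u g = y \<otimes> u g\<rbrakk> \<Longrightarrow> x = y"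
  using unit_r_cancel[OF _ u_unit u_in] by blast

lemma Ae_eqI: "\<lbrakk>g \<in> carrier G; x \<in> Ae; y \<in> Ae; x \<otimes> u g = y \<otimes> u g\<rbrakk> \<Longrightarrow> x = y"
  using u_r_cancel Ae_carrier by blast

lemma sigma_in: "\<lbrakk>g \<in> carrier G; x \<in> Ae\<rbrakk> \<Longrightarrow> \<sigma> g x \<in> Ae"
  using Ag_mult[of g "inv\<^bsub>G\<^esub> g" "u g \<otimes> x" "right_inv A (u g)"]
    Ae_mult_r[OF _ u_in] right_inv_in[OF _ u_unit u_in] by (simp add: sigma_eq)

lemma sigma_u: "\<lbrakk>g \<in> carrier G; x \<in> Ae\<rbrakk> \<Longrightarrow> \<sigma> g x \<otimes> u g = u g \<otimes> x"
  using neutral_mult_right_inv_cancel[OF _ u_unit u_in Ae_mult_r[OF _ u_in]] by (simp add: sigma_eq)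

lemma alpha_in: "\<lbrakk>g \<in> carrier G; h \<in> carrier G\<rbrakk> \<Longrightarrow> \<alpha> g h \<in> Ae"
  using Ag_mult[OF _ _ Ag_mult[OF _ _ u_in u_in] right_inv_in[OF _ u_unit u_in],
      of g h "g \<otimes>\<^bsub>G\<^esub> h"]
  by (simp add: alpha_eq)

lemma alpha_u: "\<lbrakk>g \<in> carrier G; h \<in> carrier G\<rbrakk> \<Longrightarrow> \<alpha> g h \<otimes> u (g \<otimes>\<^bsub>G\<^esub> h) = u g \<otimes> u h"
  using neutral_mult_right_inv_cancel[OF _ u_unit u_in Ag_mult[OF _ _ u_in u_in], of g h]
  by (simp add: alpha_eq)

lemma alpha_left_inv:
  assumes "g \<in> carrier G" "h \<in> carrier G"
  shows "\<alpha> g h = \<phi> (inv\<^bsub>G\<^esub> (g \<otimes>\<^bsub>G\<^esub> h)) (g \<otimes>\<^bsub>G\<^esub> h) (inv\<^bsub>G\<^esub> (g \<otimes>\<^bsub>G\<^esub> h))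
    \<odot> ((u g \<otimes> u h) \<otimes> left_inv A (u (g \<otimes>\<^bsub>G\<^esub> h)))"
proof -
  have gh: "g \<otimes>\<^bsub>G\<^esub> h \<in> carrier G"
    using assms by simp
  show ?thesis
    unfolding alpha_eq[OF assms] right_inv_eq_left_inv[OF gh u_unit[OF gh] u_in[OF gh]]
    using assms gh Ag_carrier[OF _ left_inv_in[OF gh u_unit[OF gh] u_in[OF gh]]]
    by (simp add: alg_smult_r alg_mult_closed u_carrier phi_closed del: G.inv_mult_group)
qed

lemma bij_left: "g \<in> carrier G \<Longrightarrow> bij_betw (\<lambda>x. x \<otimes> u g) Ae (Ag g)"
  unfolding bij_betw_def
proof (intro conjI equalityI subsetI)
  assume g: "g \<in> carrier G"
  show "inj_on (\<lambda>x. x \<otimes> u g) Ae"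
    using Ae_eqI[OF g] by (auto intro: inj_onI)
  show "y \<in> Ag g" if "y \<in> (\<lambda>x. x \<otimes> u g) ` Ae" for y
    using that g by (auto intro: Ae_mult_l u_in)
  show "y \<in> (\<lambda>x. x \<otimes> u g) ` Ae" if "y \<in> Ag g" for y
    using right_division[OF g u_unit[OF g] u_in[OF g] G.one_closed, of y] that g by auto
qed

lemma bij_right: "g \<in> carrier G \<Longrightarrow> bij_betw (\<lambda>x. u g \<otimes> x) Ae (Ag g)"
  unfolding bij_betw_def
proof (intro conjI equalityI subsetI)
  assume g: "g \<in> carrier G"
  show "inj_on (\<lambda>x. u g \<otimes> x) Ae"
    using unit_l_cancel[OF g u_unit[OF g] u_in[OF g]] Ae_carrier by (auto intro: inj_onI)
  show "y \<in> Ag g" if "y \<in> (\<lambda>x. u g \<otimes> x) ` Ae" for y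
    using that g by (auto intro: Ae_mult_r u_in)
  show "y \<in> (\<lambda>x. u g \<otimes> x) ` Ae" if "y \<in> Ag g" for y
    using left_division[OF g u_unit[OF g] u_in[OF g] G.one_closed, of y] that g by auto
qed

lemma Ag_eq:
  assumes "g \<in> carrier G"
  shows "Ag g = {x \<otimes> u g | x. x \<in> Ae}" "Ag g = {u g \<otimes> x | x. x \<in> Ae}"
  using bij_left[OF assms] bij_right[OF assms] by (auto simp: bij_betw_def)

text \<open>An element of degree gh can be divided on the left by \<open>u g\<close>, so a single
  product suffices and no proper sum is needed.\<close>

lemma strongly_graded: "strongly_graded G A Ag"
  unfolding strongly_graded_def
proof (intro ballI equalityI comp_mult)
  fix g h assume gh: "g \<in> carrier G" "h \<in> carrier G"
  show "Ag (g \<otimes>\<^bsub>G\<^esub> h) \<subseteq> mult_sums A (Ag g) (Ag h)"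
  proof
    fix x assume x: "x \<in> Ag (g \<otimes>\<^bsub>G\<^esub> h)"
    obtain y where y: "y \<in> Ag h" "x = u g \<otimes> y"
      using left_division[OF gh(1) u_unit[OF gh(1)] u_in[OF gh(1)] gh(2) x] by blast
    then show "x \<in> mult_sums A (Ag g) (Ag h)"
      using mult_in_mult_sums[OF u_in[OF gh(1)] y(1)] Ag_carrier[OF _ x] gh by simp
  qed
qed

lemma neutral_assoc_algebra: "assoc_algebra K E"
proof -
  interpret E: module K E
    by (rule submodule.submodule_is_module[OF comp_subspace[OF G.one_closed] vs.module_axioms])
  show ?thesis
  proof unfold_locales
    show "\<one>\<^bsub>E\<^esub> \<noteq> \<zero>\<^bsub>E\<^esub>" "\<one>\<^bsub>E\<^esub> \<in> carrier E"
      using alg_nonzero one_homogeneous by simp_all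
    show "x \<otimes>\<^bsub>E\<^esub> y \<otimes>\<^bsub>E\<^esub> z = x \<otimes>\<^bsub>E\<^esub> (y \<otimes>\<^bsub>E\<^esub> z)"
      if "x \<in> carrier E" "y \<in> carrier E" "z \<in> carrier E" for x y z
      using that assoc_l[of "\<one>\<^bsub>G\<^esub>" "\<one>\<^bsub>G\<^esub>"] by simp
  qed (simp_all add: Ae_mult Ae_carrier alg_l_distr alg_r_distr alg_smult_l alg_smult_r
      alg_l_one alg_r_one)
qed

section \<open>The axioms of a quasicrossed system over the neutral component\<close>

sublocale E: assoc_algebra K E
  by (rule neutral_assoc_algebra)

sublocale ER: ring E
  by (rule E.ring_of_algebra)

text \<open>The elements \<open>u g \<otimes> u h\<close> and \<open>u (gh)\<close> are both
  generators of the component of degree gh over \<open>Ae\<close>. While \<open>\<alpha> g h\<close>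
  turns the second into the first, the inverse \<beta> turns the first into the second.\<close>

lemma alpha_Units:
  assumes g: "g \<in> carrier G" and h: "h \<in> carrier G"
  shows "\<alpha> g h \<in> Units E"
proof -
  have gh: "g \<otimes>\<^bsub>G\<^esub> h \<in> carrier G"
    using g h by simp
  \<comment> \<open>Dividing \<open>u (gh)\<close> successively by \<open>u h\<close> and
    \<open>u g\<close> produces \<beta>.\<close>
  obtain y where y: "y \<in> Ag g" "u (g \<otimes>\<^bsub>G\<^esub> h) = y \<otimes> u h"
    using right_division[OF h u_unit[OF h] u_in[OF h] g u_in[OF gh]] by blast
  obtain \<beta> where \<beta>: "\<beta> \<in> Ae" "y = \<beta> \<otimes> u g"
    using y(1) Ag_eq(1)[OF g] by blast
  have \<beta>_mult: "\<beta> \<otimes> (u g \<otimes> u h) = u (g \<otimes>\<^bsub>G\<^esub> h)"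
    using assoc_l[OF g h \<beta>(1) u_in[OF g] u_in[OF h]] y(2) \<beta>(2) by simp
  note \<alpha> = alpha_in[OF g h] and ugh = u_in[OF gh]
  have "(\<beta> \<otimes> \<alpha> g h) \<otimes> u (g \<otimes>\<^bsub>G\<^esub> h) = \<beta> \<otimes> (\<alpha> g h \<otimes> u (g \<otimes>\<^bsub>G\<^esub> h))"
    by (rule assoc_l[OF G.one_closed gh \<beta>(1) \<alpha> ugh])
  also have "\<dots> = \<one> \<otimes> u (g \<otimes>\<^bsub>G\<^esub> h)"
    by (simp add: alpha_u[OF g h] \<beta>_mult alg_l_one[OF u_carrier[OF gh]])
  finally have l: "\<beta> \<otimes> \<alpha> g h = \<one>"
    using Ae_eqI[OF gh] Ae_mult[OF \<beta>(1) \<alpha>] one_homogeneous by blast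
  \<comment> \<open>The product \<open>u g \<otimes> u h\<close> is not one of the chosen units, so
    it is split and its factors are cancelled one at a time.\<close>
  have "((\<alpha> g h \<otimes> \<beta>) \<otimes> u g) \<otimes> u h = (\<alpha> g h \<otimes> \<beta>) \<otimes> (u g \<otimes> u h)"
    by (rule assoc_l[OF g h Ae_mult[OF \<alpha> \<beta>(1)] u_in[OF g] u_in[OF h]])
  also have "\<dots> = \<alpha> g h \<otimes> (\<beta> \<otimes> (u g \<otimes> u h))"
    by (rule assoc_l[OF G.one_closed gh \<alpha> \<beta>(1) Ag_mult[OF g h u_in[OF g] u_in[OF h]]])
  also have "\<dots> = u g \<otimes> u h"
    by (simp add: \<beta>_mult alpha_u[OF g h])
  finally have "(\<alpha> g h \<otimes> \<beta>) \<otimes> u g = u g"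
    using u_r_cancel[OF h] u_carrier[OF g] alg_mult_closed Ae_carrier[OF Ae_mult[OF \<alpha> \<beta>(1)]]
    by blast
  then have "\<alpha> g h \<otimes> \<beta> = \<one>"
    using Ae_eqI[OF g Ae_mult[OF \<alpha> \<beta>(1)] one_homogeneous] alg_l_one[OF u_carrier[OF g]] by simp
  then show ?thesis
    using l \<alpha> \<beta>(1) by (auto simp: Units_def)
qed

lemma sigma_iso:
  assumes g: "g \<in> carrier G"
  shows "\<sigma> g \<in> algebra_iso K E E"
proof -
  note ug = u_in[OF g] and ugA = u_carrier[OF g]
  have mult: "\<sigma> g (x \<otimes> y) = \<sigma> g x \<otimes> \<sigma> g y" if x: "x \<in> Ae" and y: "y \<in> Ae" for x y
  proof (rule Ae_eqI[OF g])
    have "\<sigma> g (x \<otimes> y) \<otimes> u g = (u g \<otimes> x) \<otimes> y"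
      using assoc_m[OF g G.one_closed ug x y] sigma_u[OF g Ae_mult[OF x y]] by simp
    also have "\<dots> = \<sigma> g x \<otimes> (u g \<otimes> y)"
      using assoc_l[OF g G.one_closed sigma_in[OF g x] ug y] sigma_u[OF g x] by simp
    also have "\<dots> = (\<sigma> g x \<otimes> \<sigma> g y) \<otimes> u g"
      using assoc_l[OF G.one_closed g sigma_in[OF g x] sigma_in[OF g y] ug] sigma_u[OF g y] by simp
    finally show "\<sigma> g (x \<otimes> y) \<otimes> u g = (\<sigma> g x \<otimes> \<sigma> g y) \<otimes> u g" .
  qed (use g x y in \<open>auto intro: sigma_in Ae_mult\<close>)
  have add: "\<sigma> g (x \<oplus> y) = \<sigma> g x \<oplus> \<sigma> g y" if x: "x \<in> Ae" and y: "y \<in> Ae" for x y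
    by (rule Ae_eqI[OF g])
      (use g x y Ag_add[OF G.one_closed x y] in
        \<open>auto intro: sigma_in Ag_add simp: sigma_u alg_l_distr alg_r_distr Ae_carrier ugA sigma_in\<close>)
  have smult: "\<sigma> g (c \<odot> x) = c \<odot> \<sigma> g x" if c: "c \<in> carrier K" and x: "x \<in> Ae" for c x
    by (rule Ae_eqI[OF g])
      (use g x Ag_smult[OF G.one_closed c x] c in
        \<open>auto intro: sigma_in Ag_smult simp: sigma_u alg_smult_l alg_smult_r Ae_carrier ugA sigma_in\<close>)
  have one: "\<sigma> g \<one> = \<one>"
    by (rule Ae_eqI[OF g])
      (use g ugA in \<open>auto intro: sigma_in simp: one_homogeneous sigma_u alg_l_one alg_r_one\<close>)
  have "bij_betw (\<sigma> g) Ae Ae"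
    unfolding bij_betw_def
  proof (intro conjI equalityI subsetI inj_onI)
    fix x y assume "x \<in> Ae" "y \<in> Ae" "\<sigma> g x = \<sigma> g y"
    then have "u g \<otimes> x = u g \<otimes> y"
      using sigma_u[OF g] by metis
    then show "x = y"
      using bij_right[OF g] \<open>x \<in> Ae\<close> \<open>y \<in> Ae\<close> by (auto simp: bij_betw_def inj_on_def)
  next
    fix z assume z: "z \<in> Ae"
    \<comment> \<open>The preimage of \<open>z\<close> is found by rewriting
      \<open>z \<otimes> u g\<close> with the unit on the left.\<close>
    obtain x where x: "x \<in> Ae" "z \<otimes> u g = u g \<otimes> x"
      using Ae_mult_l[OF g z ug] Ag_eq(2)[OF g] by auto
    have "\<sigma> g x = z"
      by (rule Ae_eqI[OF g sigma_in[OF g x(1)] z]) (simp only: sigma_u[OF g x(1)] x(2))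
    then show "z \<in> \<sigma> g ` Ae"
      using x(1) by auto
  qed (use sigma_in[OF g] in auto)
  then show ?thesis
    using mult add smult one sigma_in[OF g]
    by (simp add: algebra_iso_def ring_iso_def ring_hom_def Pi_iff)
qed

text \<open>Moving \<open>x\<close> leftwards through \<open>u g \<otimes> u h\<close>, either
  factor by factor or after replacing the product by \<open>\<alpha> g h \<otimes> u (gh)\<close>,
  gives the commutation relation of \<alpha> with the two automorphisms. Since \<open>x\<close> has
  degree e, no cocycle value appears, and multiplying by the inverse of \<alpha> gives the
  conjugation formula.\<close>

lemma sigma_sigma:
  assumes g: "g \<in> carrier G" and h: "h \<in> carrier G" and x: "x \<in> Ae"
  shows "\<sigma> g (\<sigma> h x) = \<alpha> g h \<otimes> \<sigma> (g \<otimes>\<^bsub>G\<^esub> h) x \<otimes> inv\<^bsub>E\<^esub> (\<alpha> g h)"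
proof -
  have gh: "g \<otimes>\<^bsub>G\<^esub> h \<in> carrier G"
    using g h by simp
  note ug = u_in[OF g] and uh = u_in[OF h] and ugh = u_in[OF gh] and \<alpha> = alpha_in[OF g h]
    and shx = sigma_in[OF h x] and sgx = sigma_in[OF gh x] and ssx = sigma_in[OF g sigma_in[OF h x]]
  have "(\<sigma> g (\<sigma> h x) \<otimes> \<alpha> g h) \<otimes> u (g \<otimes>\<^bsub>G\<^esub> h) = \<sigma> g (\<sigma> h x) \<otimes> (u g \<otimes> u h)"
    using assoc_l[OF G.one_closed gh ssx \<alpha> ugh] alpha_u[OF g h] by simp
  also have "\<dots> = (u g \<otimes> \<sigma> h x) \<otimes> u h"
    using assoc_l[OF g h ssx ug uh] sigma_u[OF g shx] by simp
  also have "\<dots> = u g \<otimes> (u h \<otimes> x)"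
    using assoc_m[OF g h ug shx uh] sigma_u[OF h x] by simp
  also have "\<dots> = (\<alpha> g h \<otimes> u (g \<otimes>\<^bsub>G\<^esub> h)) \<otimes> x"
    using assoc_r[OF g h ug uh x] alpha_u[OF g h] by simp
  also have "\<dots> = \<alpha> g h \<otimes> (\<sigma> (g \<otimes>\<^bsub>G\<^esub> h) x \<otimes> u (g \<otimes>\<^bsub>G\<^esub> h))"
    using assoc_l[OF gh G.one_closed \<alpha> ugh x] sigma_u[OF gh x] by simp
  also have "\<dots> = (\<alpha> g h \<otimes> \<sigma> (g \<otimes>\<^bsub>G\<^esub> h) x) \<otimes> u (g \<otimes>\<^bsub>G\<^esub> h)"
    using assoc_l[OF G.one_closed gh \<alpha> sgx ugh] by simp
  finally have "\<sigma> g (\<sigma> h x) \<otimes> \<alpha> g h = \<alpha> g h \<otimes> \<sigma> (g \<otimes>\<^bsub>G\<^esub> h) x"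
    using Ae_eqI[OF gh] Ae_mult \<alpha> ssx sgx by blast
  then show ?thesis
    using ER.m_assoc[of "\<sigma> g (\<sigma> h x)" "\<alpha> g h" "inv\<^bsub>E\<^esub> (\<alpha> g h)"] alpha_Units[OF g h]
      ssx \<alpha> ER.Units_inv_closed ER.Units_r_inv ER.r_one[of "\<sigma> g (\<sigma> h x)"] by simp
qed

lemma alpha_alpha:
  assumes g: "g \<in> carrier G" and h: "h \<in> carrier G" and k: "k \<in> carrier G"
  shows "\<alpha> g h \<otimes> \<alpha> (g \<otimes>\<^bsub>G\<^esub> h) k = \<phi> g h k \<odot> (\<sigma> g (\<alpha> h k) \<otimes> \<alpha> g (h \<otimes>\<^bsub>G\<^esub> k))"
proof -
  define p where "p = g \<otimes>\<^bsub>G\<^esub> h \<otimes>\<^bsub>G\<^esub> k"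
  have gh: "g \<otimes>\<^bsub>G\<^esub> h \<in> carrier G" and hk: "h \<otimes>\<^bsub>G\<^esub> k \<in> carrier G" and p: "p \<in> carrier G"
    and p': "g \<otimes>\<^bsub>G\<^esub> (h \<otimes>\<^bsub>G\<^esub> k) = p"
    using g h k by (auto simp: p_def G.m_assoc)
  note ug = u_in[OF g] and uh = u_in[OF h] and uk = u_in[OF k] and up = u_in[OF p]
    and ugh = u_in[OF gh] and uhk = u_in[OF hk]
    and a1 = alpha_in[OF g h] and a2 = alpha_in[OF gh k] and a3 = alpha_in[OF h k]
    and a4 = alpha_in[OF g hk] and sa = sigma_in[OF g alpha_in[OF h k]]
  have c: "\<phi> g h k \<in> carrier K"
    using g h k by (rule phi_closed)
  have "(\<alpha> g h \<otimes> \<alpha> (g \<otimes>\<^bsub>G\<^esub> h) k) \<otimes> u p = \<alpha> g h \<otimes> (u (g \<otimes>\<^bsub>G\<^esub> h) \<otimes> u k)"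
    using assoc_l[OF G.one_closed p a1 a2 up] alpha_u[OF gh k] by (simp add: p_def)
  also have "\<dots> = (u g \<otimes> u h) \<otimes> u k"
    using assoc_l[OF gh k a1 ugh uk] alpha_u[OF g h] by simp
  \<comment> \<open>Here three arbitrary degrees meet, which is how the cocycle enters the identity;
    all other rebracketings have a factor of degree e.\<close>
  also have "\<dots> = \<phi> g h k \<odot> (u g \<otimes> (u h \<otimes> u k))"
    by (rule quasi_assoc[OF g h k ug uh uk])
  also have "u g \<otimes> (u h \<otimes> u k) = (u g \<otimes> \<alpha> h k) \<otimes> u (h \<otimes>\<^bsub>G\<^esub> k)"
    using assoc_m[OF g hk ug a3 uhk] alpha_u[OF h k] by simp
  also have "\<dots> = \<sigma> g (\<alpha> h k) \<otimes> (u g \<otimes> u (h \<otimes>\<^bsub>G\<^esub> k))"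
    using assoc_l[OF g hk sa ug uhk] sigma_u[OF g a3] by simp
  also have "\<dots> = (\<sigma> g (\<alpha> h k) \<otimes> \<alpha> g (h \<otimes>\<^bsub>G\<^esub> k)) \<otimes> u p"
    using assoc_l[OF G.one_closed p sa a4 up] alpha_u[OF g hk] p' by simp
  also have "\<phi> g h k \<odot> \<dots> = (\<phi> g h k \<odot> (\<sigma> g (\<alpha> h k) \<otimes> \<alpha> g (h \<otimes>\<^bsub>G\<^esub> k))) \<otimes> u p"
    using alg_smult_l[OF c Ae_carrier[OF Ae_mult[OF sa a4]] u_carrier[OF p]] by simp
  finally show ?thesis
    using Ae_eqI[OF p Ae_mult[OF a1 a2] Ag_smult[OF G.one_closed c Ae_mult[OF sa a4]]] by blast
qed

lemma alpha_one:
  assumes g: "g \<in> carrier G"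
  shows "\<alpha> g \<one>\<^bsub>G\<^esub> = \<one>" "\<alpha> \<one>\<^bsub>G\<^esub> g = \<one>"
  using Ae_eqI[OF g alpha_in one_homogeneous, of g "\<one>\<^bsub>G\<^esub>"]
    Ae_eqI[OF g alpha_in one_homogeneous, of "\<one>\<^bsub>G\<^esub>" g]
    alpha_u[of g "\<one>\<^bsub>G\<^esub>"] alpha_u[of "\<one>\<^bsub>G\<^esub>" g] g u_carrier[OF g]
  by (simp_all add: u_one alg_l_one alg_r_one)

lemma quasicrossed_system: "quasicrossed_system G K E \<phi> \<sigma> \<alpha>"
  using cocycle sigma_iso alpha_Units sigma_sigma alpha_alpha alpha_one
  by unfold_locales (auto simp: E.alg_units_eq_Units)

section \<open>Free module structures and the product formula\<close>

lemma component_Ae_mult: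
  assumes "m \<in> carrier A" "x \<in> Ae" "g \<in> carrier G"
  shows "component (x \<otimes> m) g = x \<otimes> component m g" "component (m \<otimes> x) g = component m g \<otimes> x"
  using component_mult_left[OF assms(1) G.one_closed assms(2,3)]
    component_mult_right[OF assms(1) G.one_closed assms(2,3)] assms(3) by simp_all

text \<open>As \<open>m\<close> need not be homogeneous, the two sides are compared component by
  component; multiplication by \<open>Ae\<close> preserves degrees.\<close>

lemma act_assoc:
  assumes m: "m \<in> carrier A" and r: "r \<in> Ae" and s: "s \<in> Ae"
  shows "(r \<otimes> s) \<otimes> m = r \<otimes> (s \<otimes> m)" "m \<otimes> (r \<otimes> s) = (m \<otimes> r) \<otimes> s"
  by (rule component_ext; (use assms in \<open>simp add: component_Ae_mult Ae_mult Ae_carrier alg_mult_closed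
        component_in assoc_l[OF G.one_closed] assoc_r[OF _ G.one_closed]\<close>))+

lemma free_left_module: "free_left_module E A (\<lambda>x y. x \<otimes> y) (carrier G) u"
proof unfold_locales
  fix m assume "m \<in> carrier A"
  then show "\<exists>!f. f \<in> carrier G \<rightarrow>\<^sub>E carrier E \<and> finite {i \<in> carrier G. f i \<noteq> \<zero>\<^bsub>E\<^esub>} \<and>
      m = (\<Oplus>i\<in>{i \<in> carrier G. f i \<noteq> \<zero>\<^bsub>E\<^esub>}. f i \<otimes> u i)"
    using unique_expansion_of_bij[OF bij_left, of m] zero_mult u_carrier by simp
next
  fix r s m assume rsm: "r \<in> carrier E" "s \<in> carrier E" "m \<in> carrier A"
  show "(r \<otimes>\<^bsub>E\<^esub> s) \<otimes> m = r \<otimes> (s \<otimes> m)"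
    using act_assoc rsm by simp
qed (auto simp: Ae_carrier alg_mult_closed alg_l_distr alg_r_distr alg_l_one u_carrier)

lemma free_right_module: "free_right_module E A (\<lambda>y x. y \<otimes> x) (carrier G) u"
proof unfold_locales
  fix m assume "m \<in> carrier A"
  then show "\<exists>!f. f \<in> carrier G \<rightarrow>\<^sub>E carrier E \<and> finite {i \<in> carrier G. f i \<noteq> \<zero>\<^bsub>E\<^esub>} \<and>
      m = (\<Oplus>i\<in>{i \<in> carrier G. f i \<noteq> \<zero>\<^bsub>E\<^esub>}. u i \<otimes> f i)"
    using unique_expansion_of_bij[OF bij_right, of m] mult_zero u_carrier by simp
next
  fix r s m assume rsm: "r \<in> carrier E" "s \<in> carrier E" "m \<in> carrier A"
  show "m \<otimes> (r \<otimes>\<^bsub>E\<^esub> s) = (m \<otimes> r) \<otimes> s"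
    using act_assoc rsm by simp
qed (auto simp: Ae_carrier alg_mult_closed alg_l_distr alg_r_distr alg_r_one u_carrier)

text \<open>First \<open>y\<close> passes through \<open>u g\<close> by \<sigma>, then
  \<open>u g \<otimes> u h\<close> is collected by \<alpha>. Each rebracketing involves a factor
  from \<open>Ae\<close>, so no cocycle value remains.\<close>

lemma monomial_mult:
  assumes g: "g \<in> carrier G" and h: "h \<in> carrier G" and x: "x \<in> Ae" and y: "y \<in> Ae"
  shows "(x \<otimes> u g) \<otimes> (y \<otimes> u h) = (x \<otimes> \<sigma> g y \<otimes> \<alpha> g h) \<otimes> u (g \<otimes>\<^bsub>G\<^esub> h)"
proof -
  have gh: "g \<otimes>\<^bsub>G\<^esub> h \<in> carrier G"
    using g h by simp
  note ug = u_in[OF g] and uh = u_in[OF h] and sy = sigma_in[OF g y] and \<alpha> = alpha_in[OF g h]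
  have "(x \<otimes> u g) \<otimes> (y \<otimes> u h) = x \<otimes> (u g \<otimes> (y \<otimes> u h))"
    by (rule assoc_l[OF g h x ug Ae_mult_l[OF h y uh]])
  also have "u g \<otimes> (y \<otimes> u h) = (\<sigma> g y \<otimes> u g) \<otimes> u h"
    using assoc_m[OF g h ug y uh] sigma_u[OF g y] by simp
  also have "\<dots> = \<sigma> g y \<otimes> (\<alpha> g h \<otimes> u (g \<otimes>\<^bsub>G\<^esub> h))"
    using assoc_l[OF g h sy ug uh] alpha_u[OF g h] by simp
  also have "x \<otimes> \<dots> = (x \<otimes> \<sigma> g y) \<otimes> (\<alpha> g h \<otimes> u (g \<otimes>\<^bsub>G\<^esub> h))"
    using assoc_l[OF G.one_closed gh x sy Ae_mult_l[OF gh \<alpha> u_in[OF gh]]] by simp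
  also have "\<dots> = (x \<otimes> \<sigma> g y \<otimes> \<alpha> g h) \<otimes> u (g \<otimes>\<^bsub>G\<^esub> h)"
    using assoc_l[OF G.one_closed gh Ae_mult[OF x sy] \<alpha> u_in[OF gh]] by simp
  finally show ?thesis .
qed

end

section \<open>The algebra of a quasicrossed system\<close>

locale crossed_construction = quasicrossed_system G K B \<phi> \<sigma> \<alpha>
  for G :: "('g, 'l) monoid_scheme" and K :: "('k, 'm) ring_scheme"
    and B :: "('k, 'b, 'n) module_scheme" (structure) and \<phi> \<sigma> \<alpha>
begin

sublocale BR: ring B
  by (rule ring_of_algebra)

abbreviation "C \<equiv> quasicrossed_algebra G B \<sigma> \<alpha>"
abbreviation "Cg \<equiv> fmonom_comp B"

lemma sigma_hom: "g \<in> carrier G \<Longrightarrow> \<sigma> g \<in> ring_hom B B"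
  and sigma_bij: "g \<in> carrier G \<Longrightarrow> bij_betw (\<sigma> g) (carrier B) (carrier B)"
  and sigma_smult: "\<lbrakk>g \<in> carrier G; c \<in> carrier K; x \<in> carrier B\<rbrakk> \<Longrightarrow> \<sigma> g (c \<odot> x) = c \<odot> \<sigma> g x"
  using sigma_auto[of g] by (auto simp: algebra_iso_def ring_iso_def)

lemmas sigma_closed = ring_hom_closed[OF sigma_hom]
  and sigma_mult = ring_hom_mult[OF sigma_hom]
  and sigma_add = ring_hom_add[OF sigma_hom]
  and sigma_one = ring_hom_one[OF sigma_hom]

lemma sigma_zero: "g \<in> carrier G \<Longrightarrow> \<sigma> g \<zero> = \<zero>"
  using ring_hom_zero[OF sigma_hom BR.ring_axioms BR.ring_axioms] .

lemma alpha_Units: "\<lbrakk>g \<in> carrier G; h \<in> carrier G\<rbrakk> \<Longrightarrow> \<alpha> g h \<in> Units B"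
  using alpha_unit by (simp add: alg_units_eq_Units)

lemma alpha_closed: "\<lbrakk>g \<in> carrier G; h \<in> carrier G\<rbrakk> \<Longrightarrow> \<alpha> g h \<in> carrier B"
  using alpha_Units by (rule BR.Units_closed)

text \<open>Because \<alpha>(e,e) = 1, the automorphism of degree e is idempotent, and an injective
  idempotent map is the identity.\<close>

lemma sigma_neutral:
  assumes x: "x \<in> carrier B"
  shows "\<sigma> \<one>\<^bsub>G\<^esub> x = x"
proof -
  have "\<sigma> \<one>\<^bsub>G\<^esub> (\<sigma> \<one>\<^bsub>G\<^esub> x) = \<sigma> \<one>\<^bsub>G\<^esub> x"
    using sigma_sigma[of "\<one>\<^bsub>G\<^esub>" "\<one>\<^bsub>G\<^esub>" x] x alpha_one[of "\<one>\<^bsub>G\<^esub>"] sigma_closed[of "\<one>\<^bsub>G\<^esub>" x] by simp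
  then show ?thesis
    using sigma_bij[of "\<one>\<^bsub>G\<^esub>"] x sigma_closed[of "\<one>\<^bsub>G\<^esub>" x] by (auto simp: bij_betw_def inj_on_def)
qed

section \<open>Formal sums as coefficient functions\<close>

lemma carrier_C: "p \<in> carrier C \<longleftrightarrow>
    (\<forall>g\<in>carrier G. p g \<in> carrier B) \<and> (\<forall>g. g \<notin> carrier G \<longrightarrow> p g = \<zero>) \<and> finite {g. p g \<noteq> \<zero>}"
  by (auto simp: quasicrossed_algebra_def)

lemma C_simps:
  "\<zero>\<^bsub>C\<^esub> = (\<lambda>g. \<zero>)" "\<one>\<^bsub>C\<^esub> = fmonom B \<one> \<one>\<^bsub>G\<^esub>"
  "p \<oplus>\<^bsub>C\<^esub> q = (\<lambda>g. p g \<oplus> q g)" "c \<odot>\<^bsub>C\<^esub> p = (\<lambda>g. c \<odot> p g)"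
  by (simp_all add: quasicrossed_algebra_def)

lemma coeff_closed: "p \<in> carrier C \<Longrightarrow> p g \<in> carrier B"
  using carrier_C by (cases "g \<in> carrier G") auto

lemma coeff_outside: "\<lbrakk>p \<in> carrier C; g \<notin> carrier G\<rbrakk> \<Longrightarrow> p g = \<zero>"
  using carrier_C by blast

lemma finite_supp: "p \<in> carrier C \<Longrightarrow> finite {g. p g \<noteq> \<zero>}"
  using carrier_C by blast

lemma supp_subset: "p \<in> carrier C \<Longrightarrow> {g. p g \<noteq> \<zero>} \<subseteq> carrier G"
  using coeff_outside by blast

lemma fmonom_closed: "\<lbrakk>g \<in> carrier G; x \<in> carrier B\<rbrakk> \<Longrightarrow> fmonom B x g \<in> carrier C"
  by (auto simp: carrier_C fmonom_def intro: finite_subset[of _ "{g}"])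

text \<open>Vanishing wherever both \<open>p\<close> and \<open>q\<close> vanish bounds the support
  and gives zero outside the group. Unary operations use it with \<open>p\<close> taken
  twice.\<close>

lemma mem_C_I:
  assumes "p \<in> carrier C" "q \<in> carrier C" "\<And>g. g \<in> carrier G \<Longrightarrow> f g \<in> carrier B"
    and zero: "\<And>g. \<lbrakk>p g = \<zero>; q g = \<zero>\<rbrakk> \<Longrightarrow> f g = \<zero>"
  shows "f \<in> carrier C"
proof -
  have "{g. f g \<noteq> \<zero>} \<subseteq> {g. p g \<noteq> \<zero>} \<union> {g. q g \<noteq> \<zero>}"
    using zero by blast
  then have "finite {g. f g \<noteq> \<zero>}"
    using finite_supp[OF assms(1)] finite_supp[OF assms(2)] by (meson finite_UnI finite_subset)
  then show ?thesis
    using assms(3) zero coeff_outside[OF assms(1)] coeff_outside[OF assms(2)] by (simp add: carrier_C)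
qed

lemma C_abelian_group: "abelian_group C"
proof (rule abelian_groupI)
  show "p \<oplus>\<^bsub>C\<^esub> q \<in> carrier C" if "p \<in> carrier C" "q \<in> carrier C" for p q
    unfolding C_simps by (rule mem_C_I[OF that]) (auto simp: that coeff_closed)
  show "\<zero>\<^bsub>C\<^esub> \<in> carrier C"
    by (simp add: carrier_C C_simps)
  show "\<exists>q\<in>carrier C. q \<oplus>\<^bsub>C\<^esub> p = \<zero>\<^bsub>C\<^esub>" if "p \<in> carrier C" for p
  proof (intro bexI)
    show "(\<lambda>g. \<ominus> p g) \<in> carrier C"
      by (rule mem_C_I[OF that that]) (auto simp: that coeff_closed)
  qed (use that coeff_closed in \<open>simp add: C_simps vs.M.l_neg\<close>)
qed (auto simp: C_simps coeff_closed vs.M.a_ac)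

lemma C_smult_closed: "\<lbrakk>c \<in> carrier K; p \<in> carrier C\<rbrakk> \<Longrightarrow> c \<odot>\<^bsub>C\<^esub> p \<in> carrier C"
  unfolding C_simps by (rule mem_C_I[of p p]) (auto simp: coeff_closed)

lemma C_module: "module K C"
  using C_smult_closed
  by (intro moduleI K.is_cring C_abelian_group)
    (auto simp: C_simps coeff_closed vs.smult_l_distr vs.smult_r_distr vs.smult_assoc1)

sublocale C: module K C
  by (rule C_module)

text \<open>In a product of degree \<open>k\<close> the left degree \<open>g\<close> forces the
  right degree g^-1 k, so the sum over pairs becomes a sum over \<open>g\<close> alone.\<close>

definition mult_term :: "('g \<Rightarrow> 'b) \<Rightarrow> ('g \<Rightarrow> 'b) \<Rightarrow> 'g \<Rightarrow> 'g \<Rightarrow> 'b" where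
  "mult_term p q k g = p g \<otimes> \<sigma> g (q (inv\<^bsub>G\<^esub> g \<otimes>\<^bsub>G\<^esub> k)) \<otimes> \<alpha> g (inv\<^bsub>G\<^esub> g \<otimes>\<^bsub>G\<^esub> k)"

lemma mult_term_closed:
  "\<lbrakk>p \<in> carrier C; q \<in> carrier C; k \<in> carrier G; g \<in> carrier G\<rbrakk> \<Longrightarrow> mult_term p q k g \<in> carrier B"
  by (simp add: mult_term_def coeff_closed sigma_closed alpha_closed)

lemma C_mult:
  "(p \<otimes>\<^bsub>C\<^esub> q) k = (\<Oplus>gh\<in>{(g, h). p g \<noteq> \<zero> \<and> q h \<noteq> \<zero> \<and> g \<otimes>\<^bsub>G\<^esub> h = k}.
      p (fst gh) \<otimes> \<sigma> (fst gh) (q (snd gh)) \<otimes> \<alpha> (fst gh) (snd gh))"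
  by (simp add: quasicrossed_algebra_def)

text \<open>Summing over an arbitrary finite superset of the support of the left factor makes the
  multiplication visibly bilinear.\<close>

lemma C_mult_eq:
  assumes p: "p \<in> carrier C" and q: "q \<in> carrier C" and k: "k \<in> carrier G"
    and S: "finite S" "{g. p g \<noteq> \<zero>} \<subseteq> S" "S \<subseteq> carrier G"
  shows "(p \<otimes>\<^bsub>C\<^esub> q) k = (\<Oplus>g\<in>S. mult_term p q k g)"
proof -
  define D where "D = {(g, h). p g \<noteq> \<zero> \<and> q h \<noteq> \<zero> \<and> g \<otimes>\<^bsub>G\<^esub> h = k}"
  have DG: "g \<in> S" "g \<in> carrier G" "h \<in> carrier G" "h = inv\<^bsub>G\<^esub> g \<otimes>\<^bsub>G\<^esub> k" if "(g, h) \<in> D" for g h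
  proof -
    show g: "g \<in> S" "g \<in> carrier G" and h: "h \<in> carrier G"
      using that coeff_outside[OF q, of h] S(2,3) by (auto simp: D_def)
    have "inv\<^bsub>G\<^esub> g \<otimes>\<^bsub>G\<^esub> (g \<otimes>\<^bsub>G\<^esub> h) = h"
      using g h by (simp flip: G.m_assoc)
    then show "h = inv\<^bsub>G\<^esub> g \<otimes>\<^bsub>G\<^esub> k"
      using that by (simp add: D_def)
  qed
  have "(p \<otimes>\<^bsub>C\<^esub> q) k = (\<Oplus>gh\<in>D. mult_term p q k (fst gh))"
    unfolding C_mult D_def[symmetric]
  proof (rule vs.M.add.finprod_cong')
    show "(\<lambda>gh. mult_term p q k (fst gh)) \<in> D \<rightarrow> carrier B"
      using DG(2) mult_term_closed[OF p q k] by auto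
  qed (use DG(4) in \<open>fastforce simp: mult_term_def\<close>)+
  also have "\<dots> = (\<Oplus>g\<in>fst ` D. mult_term p q k g)"
  proof (rule vs.M.finsum_reindex[symmetric])
    show "mult_term p q k \<in> fst ` D \<rightarrow> carrier B"
      using DG(2) mult_term_closed[OF p q k] by auto
    show "inj_on fst D"
      by (rule inj_onI) (metis DG(4) prod.collapse)
  qed
  also have "\<dots> = (\<Oplus>g\<in>S. mult_term p q k g)"
  proof (rule vs.M.add.finprod_mono_neutral_cong_left)
    show "fst ` D \<subseteq> S"
      using DG by auto
    fix g assume g: "g \<in> S - fst ` D"
    then have gG: "g \<in> carrier G"
      using S(3) by auto
    then have "g \<otimes>\<^bsub>G\<^esub> (inv\<^bsub>G\<^esub> g \<otimes>\<^bsub>G\<^esub> k) = k"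
      using k by (simp flip: G.m_assoc)
    then have "(g, inv\<^bsub>G\<^esub> g \<otimes>\<^bsub>G\<^esub> k) \<in> D" if "p g \<noteq> \<zero>" "q (inv\<^bsub>G\<^esub> g \<otimes>\<^bsub>G\<^esub> k) \<noteq> \<zero>"
      using that by (simp add: D_def)
    then have "p g = \<zero> \<or> q (inv\<^bsub>G\<^esub> g \<otimes>\<^bsub>G\<^esub> k) = \<zero>"
      using g by force
    then show "mult_term p q k g = \<zero>"
      using gG k p q by (auto simp: mult_term_def sigma_zero sigma_closed coeff_closed alpha_closed)
  qed (use S p q k mult_term_closed in auto)
  finally show ?thesis .
qed

lemma C_mult_closed:
  assumes p: "p \<in> carrier C" and q: "q \<in> carrier C"
  shows "p \<otimes>\<^bsub>C\<^esub> q \<in> carrier C"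
proof -
  \<comment> \<open>A degree that is no product of two support degrees receives an empty sum. This
    gives finiteness of the support and vanishing outside the group together.\<close>
  have supp: "\<exists>g h. p g \<noteq> \<zero> \<and> q h \<noteq> \<zero> \<and> g \<otimes>\<^bsub>G\<^esub> h = k" if "(p \<otimes>\<^bsub>C\<^esub> q) k \<noteq> \<zero>" for k
  proof (rule ccontr)
    assume "\<nexists>g h. p g \<noteq> \<zero> \<and> q h \<noteq> \<zero> \<and> g \<otimes>\<^bsub>G\<^esub> h = k"
    then have empty: "{(g, h). p g \<noteq> \<zero> \<and> q h \<noteq> \<zero> \<and> g \<otimes>\<^bsub>G\<^esub> h = k} = {}"
      by auto
    then show False
      using that unfolding C_mult empty by simp
  qed
  then have "{k. (p \<otimes>\<^bsub>C\<^esub> q) k \<noteq> \<zero>}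
      \<subseteq> (\<lambda>(g, h). g \<otimes>\<^bsub>G\<^esub> h) ` ({g. p g \<noteq> \<zero>} \<times> {h. q h \<noteq> \<zero>})"
    by force
  then have "finite {k. (p \<otimes>\<^bsub>C\<^esub> q) k \<noteq> \<zero>}"
    by (rule finite_subset) (simp add: finite_supp p q)
  moreover have "(p \<otimes>\<^bsub>C\<^esub> q) k = \<zero>" if "k \<notin> carrier G" for k
    using supp[of k] that coeff_outside[OF p] coeff_outside[OF q] G.m_closed by metis
  moreover have "(p \<otimes>\<^bsub>C\<^esub> q) k \<in> carrier B" if k: "k \<in> carrier G" for k
  proof -
    have "mult_term p q k \<in> {g. p g \<noteq> \<zero>} \<rightarrow> carrier B"
      using supp_subset[OF p] mult_term_closed[OF p q k] by auto
    then show ?thesis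
      by (simp add: C_mult_eq[OF p q k finite_supp[OF p] subset_refl supp_subset[OF p]])
  qed
  ultimately show ?thesis
    by (simp add: carrier_C)
qed

lemma C_eqI:
  assumes "p \<in> carrier C" "q \<in> carrier C" "\<And>k. k \<in> carrier G \<Longrightarrow> p k = q k"
  shows "p = q"
proof
  fix k show "p k = q k"
    using assms(3) coeff_outside[OF assms(1)] coeff_outside[OF assms(2)]
    by (cases "k \<in> carrier G") simp_all
qed

lemma fmonom_mult:
  assumes g: "g \<in> carrier G" and h: "h \<in> carrier G" and x: "x \<in> carrier B" and y: "y \<in> carrier B"
  shows "fmonom B x g \<otimes>\<^bsub>C\<^esub> fmonom B y h = fmonom B (x \<otimes> \<sigma> g y \<otimes> \<alpha> g h) (g \<otimes>\<^bsub>G\<^esub> h)"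
proof (rule C_eqI)
  have p: "fmonom B x g \<in> carrier C" and q: "fmonom B y h \<in> carrier C"
    using assms fmonom_closed by auto
  show "fmonom B x g \<otimes>\<^bsub>C\<^esub> fmonom B y h \<in> carrier C"
    by (rule C_mult_closed[OF p q])
  show "fmonom B (x \<otimes> \<sigma> g y \<otimes> \<alpha> g h) (g \<otimes>\<^bsub>G\<^esub> h) \<in> carrier C"
    using assms by (simp add: fmonom_closed sigma_closed alpha_closed)
  fix k assume k: "k \<in> carrier G"
  have t: "mult_term (fmonom B x g) (fmonom B y h) k g \<in> carrier B"
    by (rule mult_term_closed[OF p q k g])
  \<comment> \<open>The index set {g} contains the support of the left factor even when
    \<open>x\<close> is zero.\<close>
  have "(fmonom B x g \<otimes>\<^bsub>C\<^esub> fmonom B y h) k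
      = (\<Oplus>g'\<in>{g}. mult_term (fmonom B x g) (fmonom B y h) k g')"
    using g by (intro C_mult_eq[OF p q k]) (auto simp: fmonom_def)
  also have "\<dots> = mult_term (fmonom B x g) (fmonom B y h) k g"
    using t by simp
  also have "\<dots> = fmonom B (x \<otimes> \<sigma> g y \<otimes> \<alpha> g h) (g \<otimes>\<^bsub>G\<^esub> h) k"
  proof (cases "k = g \<otimes>\<^bsub>G\<^esub> h")
    case True
    then have "inv\<^bsub>G\<^esub> g \<otimes>\<^bsub>G\<^esub> k = h"
      using g h by (simp flip: G.m_assoc)
    then show ?thesis
      using True by (simp add: mult_term_def fmonom_def)
  next
    case False
    then have "inv\<^bsub>G\<^esub> g \<otimes>\<^bsub>G\<^esub> k \<noteq> h"
      using g h k by (auto simp flip: G.m_assoc)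
    then show ?thesis
      using False g k x by (simp add: mult_term_def fmonom_def sigma_zero alpha_closed)
  qed
  finally show "(fmonom B x g \<otimes>\<^bsub>C\<^esub> fmonom B y h) k
    = fmonom B (x \<otimes> \<sigma> g y \<otimes> \<alpha> g h) (g \<otimes>\<^bsub>G\<^esub> h) k" .
qed

lemma C_one_closed: "\<one>\<^bsub>C\<^esub> \<in> carrier C"
  by (simp add: C_simps fmonom_closed)

lemma C_one_mult:
  assumes p: "p \<in> carrier C"
  shows "\<one>\<^bsub>C\<^esub> \<otimes>\<^bsub>C\<^esub> p = p"
proof (rule C_eqI)
  note one = C_one_closed
  then show "\<one>\<^bsub>C\<^esub> \<otimes>\<^bsub>C\<^esub> p \<in> carrier C"
    by (rule C_mult_closed[OF _ p])
  fix k assume k: "k \<in> carrier G"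
  have t: "mult_term \<one>\<^bsub>C\<^esub> p k \<one>\<^bsub>G\<^esub> = p k"
    using k p alpha_one[OF k]
    by (simp add: mult_term_def C_simps fmonom_def sigma_neutral coeff_closed)
  have "(\<one>\<^bsub>C\<^esub> \<otimes>\<^bsub>C\<^esub> p) k = (\<Oplus>g\<in>{\<one>\<^bsub>G\<^esub>}. mult_term \<one>\<^bsub>C\<^esub> p k g)"
    by (intro C_mult_eq[OF one p k]) (auto simp: C_simps fmonom_def)
  then show "(\<one>\<^bsub>C\<^esub> \<otimes>\<^bsub>C\<^esub> p) k = p k"
    using t coeff_closed[OF p, of k] by simp
qed (rule p)

lemma C_mult_one:
  assumes p: "p \<in> carrier C"
  shows "p \<otimes>\<^bsub>C\<^esub> \<one>\<^bsub>C\<^esub> = p"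
proof (rule C_eqI)
  note one = C_one_closed
  then show "p \<otimes>\<^bsub>C\<^esub> \<one>\<^bsub>C\<^esub> \<in> carrier C"
    by (rule C_mult_closed[OF p])
  fix k assume k: "k \<in> carrier G"
  \<comment> \<open>The index \<open>k\<close> carries the only possibly nonzero term, and it must
    be present even if \<open>p k\<close> is zero.\<close>
  define S where "S = insert k {g. p g \<noteq> \<zero>}"
  have S: "finite S" "{g. p g \<noteq> \<zero>} \<subseteq> S" "S \<subseteq> carrier G"
    using finite_supp[OF p] supp_subset[OF p] k by (auto simp: S_def)
  have t: "mult_term p \<one>\<^bsub>C\<^esub> k g = (if k = g then p g else \<zero>)" if "g \<in> S" for g
  proof -
    have g: "g \<in> carrier G"
      using S(3) that by auto
    have "inv\<^bsub>G\<^esub> g \<otimes>\<^bsub>G\<^esub> k = \<one>\<^bsub>G\<^esub> \<longleftrightarrow> k = g"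
      using G.inv_solve_left'[OF G.one_closed g k] g by (auto simp: eq_commute)
    then show ?thesis
      using g k p alpha_one[OF g]
      by (auto simp: mult_term_def C_simps fmonom_def sigma_zero sigma_one coeff_closed alpha_closed)
  qed
  have "(p \<otimes>\<^bsub>C\<^esub> \<one>\<^bsub>C\<^esub>) k = (\<Oplus>g\<in>S. mult_term p \<one>\<^bsub>C\<^esub> k g)"
    by (rule C_mult_eq[OF p one k S])
  also have "\<dots> = (\<Oplus>g\<in>S. if k = g then p g else \<zero>)"
    using t coeff_closed[OF p] by (intro vs.M.add.finprod_cong') auto
  also have "\<dots> = p k"
    using S(1) coeff_closed[OF p] by (intro vs.M.finsum_singleton) (auto simp: S_def)
  finally show "(p \<otimes>\<^bsub>C\<^esub> \<one>\<^bsub>C\<^esub>) k = p k" .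
qed (rule p)

lemma C_l_distr:
  assumes p: "p \<in> carrier C" and p': "p' \<in> carrier C" and q: "q \<in> carrier C"
  shows "(p \<oplus>\<^bsub>C\<^esub> p') \<otimes>\<^bsub>C\<^esub> q = p \<otimes>\<^bsub>C\<^esub> q \<oplus>\<^bsub>C\<^esub> p' \<otimes>\<^bsub>C\<^esub> q"
proof (rule C_eqI)
  have pp: "p \<oplus>\<^bsub>C\<^esub> p' \<in> carrier C"
    using p p' by simp
  show "(p \<oplus>\<^bsub>C\<^esub> p') \<otimes>\<^bsub>C\<^esub> q \<in> carrier C" "p \<otimes>\<^bsub>C\<^esub> q \<oplus>\<^bsub>C\<^esub> p' \<otimes>\<^bsub>C\<^esub> q \<in> carrier C"
    using pp p p' q by (auto simp: C_mult_closed)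
  fix k assume k: "k \<in> carrier G"
  \<comment> \<open>All three products are summed over the union of the supports; cancellation can
    make the support of the sum smaller.\<close>
  define S where "S = {g. p g \<noteq> \<zero>} \<union> {g. p' g \<noteq> \<zero>}"
  have S: "finite S" "S \<subseteq> carrier G"
    using finite_supp supp_subset p p' by (auto simp: S_def)
  have sub: "{g. p g \<noteq> \<zero>} \<subseteq> S" "{g. p' g \<noteq> \<zero>} \<subseteq> S" "{g. (p \<oplus>\<^bsub>C\<^esub> p') g \<noteq> \<zero>} \<subseteq> S"
    by (auto simp: S_def C_simps)
  have t: "mult_term p q k \<in> S \<rightarrow> carrier B" "mult_term p' q k \<in> S \<rightarrow> carrier B"
    using mult_term_closed[OF _ q k] p p' S(2) by auto
  have "((p \<oplus>\<^bsub>C\<^esub> p') \<otimes>\<^bsub>C\<^esub> q) k = (\<Oplus>g\<in>S. mult_term (p \<oplus>\<^bsub>C\<^esub> p') q k g)"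
    by (rule C_mult_eq[OF pp q k S(1) sub(3) S(2)])
  also have "\<dots> = (\<Oplus>g\<in>S. mult_term p q k g \<oplus> mult_term p' q k g)"
    using t S(2) k p p' q
    by (intro vs.M.add.finprod_cong')
      (auto simp: mult_term_def C_simps coeff_closed sigma_closed alpha_closed BR.l_distr subset_iff)
  also have "\<dots> = (\<Oplus>g\<in>S. mult_term p q k g) \<oplus> (\<Oplus>g\<in>S. mult_term p' q k g)"
    by (rule vs.M.finsum_addf[OF t])
  finally show "((p \<oplus>\<^bsub>C\<^esub> p') \<otimes>\<^bsub>C\<^esub> q) k = (p \<otimes>\<^bsub>C\<^esub> q \<oplus>\<^bsub>C\<^esub> p' \<otimes>\<^bsub>C\<^esub> q) k"
    by (simp add: C_simps(3) C_mult_eq[OF p q k S(1) sub(1) S(2)]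
        C_mult_eq[OF p' q k S(1) sub(2) S(2)])
qed

lemma C_r_distr:
  assumes p: "p \<in> carrier C" and q: "q \<in> carrier C" and q': "q' \<in> carrier C"
  shows "p \<otimes>\<^bsub>C\<^esub> (q \<oplus>\<^bsub>C\<^esub> q') = p \<otimes>\<^bsub>C\<^esub> q \<oplus>\<^bsub>C\<^esub> p \<otimes>\<^bsub>C\<^esub> q'"
proof (rule C_eqI)
  have qq: "q \<oplus>\<^bsub>C\<^esub> q' \<in> carrier C"
    using q q' by simp
  show "p \<otimes>\<^bsub>C\<^esub> (q \<oplus>\<^bsub>C\<^esub> q') \<in> carrier C" "p \<otimes>\<^bsub>C\<^esub> q \<oplus>\<^bsub>C\<^esub> p \<otimes>\<^bsub>C\<^esub> q' \<in> carrier C"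
    using qq p q q' by (auto simp: C_mult_closed)
  fix k assume k: "k \<in> carrier G"
  note mult_eq = C_mult_eq[OF p _ k finite_supp[OF p] subset_refl supp_subset[OF p]]
  let ?S = "{g. p g \<noteq> \<zero>}"
  have t: "mult_term p q k \<in> ?S \<rightarrow> carrier B" "mult_term p q' k \<in> ?S \<rightarrow> carrier B"
    using mult_term_closed[OF p _ k] q q' supp_subset[OF p] by auto
  have "(\<Oplus>g\<in>?S. mult_term p (q \<oplus>\<^bsub>C\<^esub> q') k g) = (\<Oplus>g\<in>?S. mult_term p q k g \<oplus> mult_term p q' k g)"
    using t supp_subset[OF p] k p q q'
    by (intro vs.M.add.finprod_cong')
      (auto simp: mult_term_def C_simps coeff_closed sigma_closed sigma_add alpha_closed BR.l_distr
        BR.r_distr subset_iff)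
  also have "\<dots> = (\<Oplus>g\<in>?S. mult_term p q k g) \<oplus> (\<Oplus>g\<in>?S. mult_term p q' k g)"
    by (rule vs.M.finsum_addf[OF t])
  finally show "(p \<otimes>\<^bsub>C\<^esub> (q \<oplus>\<^bsub>C\<^esub> q')) k = (p \<otimes>\<^bsub>C\<^esub> q \<oplus>\<^bsub>C\<^esub> p \<otimes>\<^bsub>C\<^esub> q') k"
    by (simp add: C_simps(3) mult_eq[OF qq[unfolded C_simps(3)]] mult_eq[OF q] mult_eq[OF q'])
qed

lemma C_smult_mult:
  assumes c: "c \<in> carrier K" and p: "p \<in> carrier C" and q: "q \<in> carrier C"
  shows "(c \<odot>\<^bsub>C\<^esub> p) \<otimes>\<^bsub>C\<^esub> q = c \<odot>\<^bsub>C\<^esub> (p \<otimes>\<^bsub>C\<^esub> q)" "p \<otimes>\<^bsub>C\<^esub> (c \<odot>\<^bsub>C\<^esub> q) = c \<odot>\<^bsub>C\<^esub> (p \<otimes>\<^bsub>C\<^esub> q)"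
proof -
  have cp: "c \<odot>\<^bsub>C\<^esub> p \<in> carrier C" and cq: "c \<odot>\<^bsub>C\<^esub> q \<in> carrier C"
    using c p q by auto
  let ?S = "{g. p g \<noteq> \<zero>}"
  have S: "finite ?S" "?S \<subseteq> carrier G"
    using finite_supp[OF p] supp_subset[OF p] by auto
  \<comment> \<open>Scaling can only shrink the support, so the support of \<open>p\<close> indexes
    all the sums.\<close>
  have sub: "{g. (c \<odot>\<^bsub>C\<^esub> p) g \<noteq> \<zero>} \<subseteq> ?S"
    using c by (auto simp: C_simps)
  have sum: "(\<Oplus>g\<in>?S. c \<odot> mult_term p q k g) = c \<odot> (p \<otimes>\<^bsub>C\<^esub> q) k" if k: "k \<in> carrier G" for k
  proof -
    have "mult_term p q k \<in> ?S \<rightarrow> carrier B"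
      using mult_term_closed[OF p q k] S(2) by auto
    then show ?thesis
      by (simp add: vs.finsum_smult_ldistr[OF S(1) c] C_mult_eq[OF p q k S(1) subset_refl S(2)])
  qed
  have t: "(\<lambda>g. c \<odot> mult_term p q k g) \<in> ?S \<rightarrow> carrier B" if k: "k \<in> carrier G" for k
    using mult_term_closed[OF p q k] S(2) c by auto
  show "(c \<odot>\<^bsub>C\<^esub> p) \<otimes>\<^bsub>C\<^esub> q = c \<odot>\<^bsub>C\<^esub> (p \<otimes>\<^bsub>C\<^esub> q)"
  proof (rule C_eqI)
    fix k assume k: "k \<in> carrier G"
    have "((c \<odot>\<^bsub>C\<^esub> p) \<otimes>\<^bsub>C\<^esub> q) k = (\<Oplus>g\<in>?S. mult_term (c \<odot>\<^bsub>C\<^esub> p) q k g)"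
      by (rule C_mult_eq[OF cp q k S(1) sub S(2)])
    also have "\<dots> = (\<Oplus>g\<in>?S. c \<odot> mult_term p q k g)"
      using t[OF k] S(2) k c p q
      by (intro vs.M.add.finprod_cong')
        (auto simp: mult_term_def C_simps coeff_closed sigma_closed alpha_closed alg_smult_l subset_iff)
    finally show "((c \<odot>\<^bsub>C\<^esub> p) \<otimes>\<^bsub>C\<^esub> q) k = (c \<odot>\<^bsub>C\<^esub> (p \<otimes>\<^bsub>C\<^esub> q)) k"
      using sum[OF k] by (simp add: C_simps(4))
  qed (use c p q cp in \<open>auto simp: C_mult_closed\<close>)
  show "p \<otimes>\<^bsub>C\<^esub> (c \<odot>\<^bsub>C\<^esub> q) = c \<odot>\<^bsub>C\<^esub> (p \<otimes>\<^bsub>C\<^esub> q)"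
  proof (rule C_eqI)
    fix k assume k: "k \<in> carrier G"
    have "(p \<otimes>\<^bsub>C\<^esub> (c \<odot>\<^bsub>C\<^esub> q)) k = (\<Oplus>g\<in>?S. mult_term p (c \<odot>\<^bsub>C\<^esub> q) k g)"
      by (rule C_mult_eq[OF p cq k S(1) subset_refl S(2)])
    also have "\<dots> = (\<Oplus>g\<in>?S. c \<odot> mult_term p q k g)"
      using t[OF k] S(2) k c p q
      by (intro vs.M.add.finprod_cong')
        (auto simp: mult_term_def C_simps coeff_closed sigma_closed sigma_smult alpha_closed
          alg_smult_l alg_smult_r subset_iff)
    finally show "(p \<otimes>\<^bsub>C\<^esub> (c \<odot>\<^bsub>C\<^esub> q)) k = (c \<odot>\<^bsub>C\<^esub> (p \<otimes>\<^bsub>C\<^esub> q)) k"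
      using sum[OF k] by (simp add: C_simps(4))
  qed (use c p q cq in \<open>auto simp: C_mult_closed\<close>)
qed

lemma fmonom_eq_iff: "fmonom B x g = fmonom B y g \<longleftrightarrow> x = y"
  by (metis fmonom_def)

lemma C_unital_algebra: "unital_algebra K C"
proof (unfold_locales, goal_cases)
  \<comment> \<open>This is the requirement that one and zero differ in \<open>C\<close>, inherited
    from \<open>B\<close> by evaluating at the neutral element.\<close>
  case 9
  then show ?case
    using alg_nonzero by (auto simp: C_simps fmonom_def fun_eq_iff)
qed (auto simp: C_mult_closed C_l_distr C_r_distr C_smult_mult C_one_mult C_mult_one
    C_one_closed)

sublocale C: unital_algebra K C
  by (rule C_unital_algebra)

section \<open>Finite sums and free generation by the monomials\<close>

lemma finsum_C:
  assumes "finite F" "P \<in> F \<rightarrow> carrier C"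
  shows "(\<Oplus>\<^bsub>C\<^esub>i\<in>F. P i) k = (\<Oplus>i\<in>F. P i k)"
  using assms
proof (induction F)
  case empty
  then show ?case by (simp add: C_simps(1))
next
  case (insert a F)
  have "(\<Oplus>\<^bsub>C\<^esub>i\<in>insert a F. P i) k = (P a \<oplus>\<^bsub>C\<^esub> (\<Oplus>\<^bsub>C\<^esub>i\<in>F. P i)) k"
    using insert by (subst C.M.finsum_insert) auto
  also have "\<dots> = P a k \<oplus> (\<Oplus>i\<in>F. P i k)"
    using insert by (simp add: C_simps(3))
  also have "\<dots> = (\<Oplus>i\<in>insert a F. P i k)"
    using insert coeff_closed by (subst vs.M.finsum_insert) (auto simp: Pi_iff)
  finally show ?case .
qed

text \<open>Evaluation at \<open>k\<close> isolates the term of degree \<open>k\<close>; this is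
  what makes the expansions and the decompositions below unique.\<close>

lemma finsum_fmonom:
  assumes F: "finite F" "F \<subseteq> carrier G" and c: "c \<in> F \<rightarrow> carrier B"
  shows "(\<Oplus>\<^bsub>C\<^esub>g\<in>F. fmonom B (c g) g) k = (if k \<in> F then c k else \<zero>)"
proof -
  have "(\<Oplus>\<^bsub>C\<^esub>g\<in>F. fmonom B (c g) g) k = (\<Oplus>g\<in>F. if k = g then c g else \<zero>)"
  proof (subst finsum_C[OF F(1)])
    show "(\<lambda>g. fmonom B (c g) g) \<in> F \<rightarrow> carrier C"
      using F(2) c fmonom_closed by blast
  qed (simp add: fmonom_def)
  also have "\<dots> = (if k \<in> F then c k else \<zero>)"
  proof (cases "k \<in> F")
    case True
    then show ?thesis
      using vs.M.finsum_singleton[OF True F(1) c] by simp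
  next
    case False
    then have "(\<Oplus>g\<in>F. if k = g then c g else \<zero>) = \<zero>"
      by (intro vs.M.add.finprod_one_eqI) auto
    then show ?thesis
      using False by simp
  qed
  finally show ?thesis .
qed

lemma fmonom_expansion:
  assumes p: "p \<in> carrier C"
  shows "(\<Oplus>\<^bsub>C\<^esub>g\<in>{g. p g \<noteq> \<zero>}. fmonom B (p g) g) = p"
proof (rule C_eqI)
  have "(\<lambda>g. fmonom B (p g) g) \<in> {g. p g \<noteq> \<zero>} \<rightarrow> carrier C"
    using supp_subset[OF p] coeff_closed[OF p] fmonom_closed by blast
  then show "(\<Oplus>\<^bsub>C\<^esub>g\<in>{g. p g \<noteq> \<zero>}. fmonom B (p g) g) \<in> carrier C"
    by simp
  show "(\<Oplus>\<^bsub>C\<^esub>g\<in>{g. p g \<noteq> \<zero>}. fmonom B (p g) g) k = p k" for k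
    using finsum_fmonom[OF finite_supp[OF p] supp_subset[OF p], of p k] coeff_closed[OF p] by auto
qed (rule p)

lemma fmonom_unique_expansion:
  assumes p: "p \<in> carrier C"
  shows "\<exists>!f. f \<in> carrier G \<rightarrow>\<^sub>E carrier B \<and> finite {g \<in> carrier G. f g \<noteq> \<zero>} \<and>
    p = (\<Oplus>\<^bsub>C\<^esub>g\<in>{g \<in> carrier G. f g \<noteq> \<zero>}. fmonom B (f g) g)"
proof (rule ex1I[of _ "restrict p (carrier G)"])
  have supp: "{g \<in> carrier G. restrict p (carrier G) g \<noteq> \<zero>} = {g. p g \<noteq> \<zero>}"
    using supp_subset[OF p] by auto
  have "(\<Oplus>\<^bsub>C\<^esub>g\<in>{g. p g \<noteq> \<zero>}. fmonom B (restrict p (carrier G) g) g)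
      = (\<Oplus>\<^bsub>C\<^esub>g\<in>{g. p g \<noteq> \<zero>}. fmonom B (p g) g)"
    using supp_subset[OF p] coeff_closed[OF p] fmonom_closed
    by (intro C.M.add.finprod_cong') (auto simp: subset_iff)
  then show "restrict p (carrier G) \<in> carrier G \<rightarrow>\<^sub>E carrier B \<and>
      finite {g \<in> carrier G. restrict p (carrier G) g \<noteq> \<zero>} \<and>
      p = (\<Oplus>\<^bsub>C\<^esub>g\<in>{g \<in> carrier G. restrict p (carrier G) g \<noteq> \<zero>}.
        fmonom B (restrict p (carrier G) g) g)"
    unfolding supp using finite_supp[OF p] coeff_closed[OF p] fmonom_expansion[OF p] by auto
next
  fix f assume f: "f \<in> carrier G \<rightarrow>\<^sub>E carrier B \<and> finite {g \<in> carrier G. f g \<noteq> \<zero>} \<and>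
    p = (\<Oplus>\<^bsub>C\<^esub>g\<in>{g \<in> carrier G. f g \<noteq> \<zero>}. fmonom B (f g) g)"
  show "f = restrict p (carrier G)"
  proof (rule PiE_ext)
    show "f \<in> carrier G \<rightarrow>\<^sub>E carrier B" "restrict p (carrier G) \<in> carrier G \<rightarrow>\<^sub>E carrier B"
      using f coeff_closed[OF p] by auto
    fix k assume k: "k \<in> carrier G"
    have "f \<in> {g \<in> carrier G. f g \<noteq> \<zero>} \<rightarrow> carrier B"
      using f by auto
    then have "p k = (if k \<in> {g \<in> carrier G. f g \<noteq> \<zero>} then f k else \<zero>)"
      using finsum_fmonom[of "{g \<in> carrier G. f g \<noteq> \<zero>}" f k] f by auto
    then show "f k = restrict p (carrier G) k"
      using k by (auto split: if_splits)
  qed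
qed

lemma coeff_act_fmonom: "x \<in> carrier B \<Longrightarrow> coeff_act B x (fmonom B \<one> g) = fmonom B x g"
  by (auto simp: coeff_act_def fmonom_def)

lemma C_free_left_module: "free_left_module B C (coeff_act B) (carrier G) (fmonom B \<one>)"
proof (unfold_locales, goal_cases)
  case (1 r m)
  show ?case
    unfolding coeff_act_def by (rule mem_C_I[OF 1(2,2)]) (use 1 in \<open>auto simp: coeff_closed\<close>)
next
  case (7 m)
  have "(\<Oplus>\<^bsub>C\<^esub>g\<in>{g \<in> carrier G. f g \<noteq> \<zero>}. coeff_act B (f g) (fmonom B \<one> g))
      = (\<Oplus>\<^bsub>C\<^esub>g\<in>{g \<in> carrier G. f g \<noteq> \<zero>}. fmonom B (f g) g)"
    if "f \<in> carrier G \<rightarrow>\<^sub>E carrier B" for f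
    using that fmonom_closed
    by (intro C.M.add.finprod_cong') (auto simp: PiE_iff coeff_act_fmonom)
  then show ?case
    using fmonom_unique_expansion[OF 7] by (smt (verit))
qed (auto simp: coeff_act_def C_simps coeff_closed BR.l_distr BR.r_distr BR.m_assoc fmonom_closed)

section \<open>The grading by monomials\<close>

lemma Cg_eq: "g \<in> carrier G \<Longrightarrow> p \<in> Cg g \<longleftrightarrow> p \<in> carrier C \<and> (\<forall>k. k \<noteq> g \<longrightarrow> p k = \<zero>)"
  unfolding fmonom_comp_def
  using fmonom_closed coeff_closed[of p g] by (fastforce simp: fmonom_def fun_eq_iff)

lemma Cg_cases:
  assumes "p \<in> Cg g"
  obtains x where "x \<in> carrier B" "p = fmonom B x g"
  using assms by (auto simp: fmonom_comp_def)

lemma fmonom_in_Cg: "x \<in> carrier B \<Longrightarrow> fmonom B x g \<in> Cg g"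
  by (auto simp: fmonom_comp_def)

lemma fmonom_zero: "fmonom B \<zero> g = \<zero>\<^bsub>C\<^esub>"
  by (auto simp: fmonom_def C_simps)

lemma fmonom_eq_zero_iff: "fmonom B x g = \<zero>\<^bsub>C\<^esub> \<longleftrightarrow> x = \<zero>"
  using fmonom_eq_iff[of x g \<zero>] fmonom_zero[of g] by simp

lemma Cg_submodule:
  assumes g: "g \<in> carrier G"
  shows "submodule (Cg g) K C"
proof (rule C.submoduleI)
  show "Cg g \<subseteq> carrier C" "\<zero>\<^bsub>C\<^esub> \<in> Cg g"
    using Cg_eq[OF g] by (auto simp: C_simps(1) carrier_C)
  show "\<ominus>\<^bsub>C\<^esub> p \<in> Cg g" if p: "p \<in> Cg g" for p
  proof -
    obtain x where x: "x \<in> carrier B" "p = fmonom B x g"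
      using p by (rule Cg_cases)
    have "fmonom B (\<ominus> x) g \<oplus>\<^bsub>C\<^esub> p = \<zero>\<^bsub>C\<^esub>"
      using x by (auto simp: C_simps fmonom_def vs.M.l_neg)
    then have "\<ominus>\<^bsub>C\<^esub> p = fmonom B (\<ominus> x) g"
      using x g by (intro C.M.minus_equality) (auto intro: fmonom_closed)
    then show ?thesis
      using x by (simp add: fmonom_in_Cg)
  qed
  show "p \<oplus>\<^bsub>C\<^esub> q \<in> Cg g" if "p \<in> Cg g" "q \<in> Cg g" for p q
    using that C.M.a_closed[of p q] by (simp add: Cg_eq[OF g] C_simps(3))
  show "c \<odot>\<^bsub>C\<^esub> p \<in> Cg g" if "c \<in> carrier K" "p \<in> Cg g" for c p
    using that C_smult_closed[of c p] by (simp add: Cg_eq[OF g] C_simps(4))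
qed

lemma Cg_direct_sum:
  assumes p: "p \<in> carrier C"
  shows "\<exists>!f. f \<in> (\<Pi>\<^sub>E g\<in>carrier G. Cg g) \<and> finite {g \<in> carrier G. f g \<noteq> \<zero>\<^bsub>C\<^esub>} \<and>
    p = (\<Oplus>\<^bsub>C\<^esub>g\<in>{g \<in> carrier G. f g \<noteq> \<zero>\<^bsub>C\<^esub>}. f g)"
proof (rule ex1I[of _ "\<lambda>g\<in>carrier G. fmonom B (p g) g"])
  let ?f = "\<lambda>g\<in>carrier G. fmonom B (p g) g"
  have supp: "{g \<in> carrier G. ?f g \<noteq> \<zero>\<^bsub>C\<^esub>} = {g. p g \<noteq> \<zero>}"
    using supp_subset[OF p] by (auto simp: fmonom_eq_zero_iff)
  have "(\<Oplus>\<^bsub>C\<^esub>g\<in>{g. p g \<noteq> \<zero>}. ?f g) = (\<Oplus>\<^bsub>C\<^esub>g\<in>{g. p g \<noteq> \<zero>}. fmonom B (p g) g)"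
    using supp_subset[OF p] coeff_closed[OF p] fmonom_closed
    by (intro C.M.add.finprod_cong') (auto simp: subset_iff)
  then show "?f \<in> (\<Pi>\<^sub>E g\<in>carrier G. Cg g) \<and> finite {g \<in> carrier G. ?f g \<noteq> \<zero>\<^bsub>C\<^esub>} \<and>
    p = (\<Oplus>\<^bsub>C\<^esub>g\<in>{g \<in> carrier G. ?f g \<noteq> \<zero>\<^bsub>C\<^esub>}. ?f g)"
    unfolding supp using finite_supp[OF p] coeff_closed[OF p] fmonom_expansion[OF p]
      fmonom_in_Cg[OF coeff_closed[OF p]] by auto
next
  fix f assume f: "f \<in> (\<Pi>\<^sub>E g\<in>carrier G. Cg g) \<and> finite {g \<in> carrier G. f g \<noteq> \<zero>\<^bsub>C\<^esub>} \<and>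
    p = (\<Oplus>\<^bsub>C\<^esub>g\<in>{g \<in> carrier G. f g \<noteq> \<zero>\<^bsub>C\<^esub>}. f g)"
  define F where "F = {g \<in> carrier G. f g \<noteq> \<zero>\<^bsub>C\<^esub>}"
  \<comment> \<open>A member of the component of degree \<open>g\<close> is determined by its value
    at \<open>g\<close>, so the family is determined by its diagonal, which the sum \<open>p\<close>
    displays.\<close>
  have fC: "f g \<in> carrier C \<and> f g = fmonom B (f g g) g" if g: "g \<in> carrier G" for g
    using f g Cg_eq[OF g, of "f g"] by (fastforce simp: fmonom_def)
  have F: "finite F" "F \<subseteq> carrier G" "(\<lambda>g. f g g) \<in> F \<rightarrow> carrier B"
    using f fC coeff_closed by (auto simp: F_def)
  have "p = (\<Oplus>\<^bsub>C\<^esub>g\<in>F. fmonom B (f g g) g)"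
    using f fC by (auto simp: F_def intro!: C.M.add.finprod_cong')
  then have pk: "p k = (if k \<in> F then f k k else \<zero>)" for k
    using finsum_fmonom[OF F] by simp
  show "f = (\<lambda>g\<in>carrier G. fmonom B (p g) g)"
  proof (rule PiE_ext)
    show "f \<in> (\<Pi>\<^sub>E g\<in>carrier G. Cg g)" "(\<lambda>g\<in>carrier G. fmonom B (p g) g) \<in> (\<Pi>\<^sub>E g\<in>carrier G. Cg g)"
      using conjunct1[OF f] fmonom_in_Cg[OF coeff_closed[OF p]] by auto
    fix k assume k: "k \<in> carrier G"
    have "p k = f k k"
      using pk[of k] k by (auto simp: F_def C_simps(1))
    then show "f k = (\<lambda>g\<in>carrier G. fmonom B (p g) g) k"
      using fC[OF k] k by simp
  qed
qed

lemma Cg_mult: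
  assumes "g \<in> carrier G" "h \<in> carrier G" "p \<in> Cg g" "q \<in> Cg h"
  shows "p \<otimes>\<^bsub>C\<^esub> q \<in> Cg (g \<otimes>\<^bsub>G\<^esub> h)"
  using assms by (auto elim!: Cg_cases simp: fmonom_mult sigma_closed alpha_closed fmonom_in_Cg)

lemma C_graded_algebra: "graded_algebra G K C Cg"
proof (intro graded_algebra.intro G.group_axioms C_unital_algebra graded_algebra_axioms.intro
    Cg_submodule Cg_direct_sum)
  fix g h assume gh: "g \<in> carrier G" "h \<in> carrier G"
  then have ghG: "g \<otimes>\<^bsub>G\<^esub> h \<in> carrier G"
    by simp
  show "mult_sums C (Cg g) (Cg h) \<subseteq> Cg (g \<otimes>\<^bsub>G\<^esub> h)"
  proof
    fix s assume "s \<in> mult_sums C (Cg g) (Cg h)"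
    then obtain n :: nat and x y where s: "s = (\<Oplus>\<^bsub>C\<^esub>i\<in>{..<n}. x i \<otimes>\<^bsub>C\<^esub> y i)"
      and xy: "x \<in> {..<n} \<rightarrow> Cg g" "y \<in> {..<n} \<rightarrow> Cg h"
      by (auto simp: mult_sums_def)
    have terms: "x i \<otimes>\<^bsub>C\<^esub> y i \<in> Cg (g \<otimes>\<^bsub>G\<^esub> h)" if "i < n" for i
      using that xy gh by (auto intro: Cg_mult)
    then have P: "(\<lambda>i. x i \<otimes>\<^bsub>C\<^esub> y i) \<in> {..<n} \<rightarrow> carrier C"
      using Cg_eq[OF ghG] by auto
    have "s k = \<zero>" if "k \<noteq> g \<otimes>\<^bsub>G\<^esub> h" for k
      unfolding s finsum_C[OF finite_lessThan P] using terms Cg_eq[OF ghG] that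
      by (intro vs.M.add.finprod_one_eqI) auto
    moreover have "s \<in> carrier C"
      unfolding s using P by (rule C.M.finsum_closed)
    ultimately show "s \<in> Cg (g \<otimes>\<^bsub>G\<^esub> h)"
      using Cg_eq[OF ghG] by blast
  qed
next
  \<comment> \<open>Every component contains the symbol of its degree, which is nonzero since
    \<open>B\<close> is. The support is therefore all of the group.\<close>
  have "Cg g \<noteq> {\<zero>\<^bsub>C\<^esub>}" for g
    using fmonom_in_Cg[OF alg_one_closed, of g] fmonom_eq_iff[of \<one> g \<zero>] fmonom_zero[of g]
      alg_nonzero by auto
  then have "{g \<in> carrier G. Cg g \<noteq> {\<zero>\<^bsub>C\<^esub>}} = carrier G"
    by auto
  then show "generate G {g \<in> carrier G. Cg g \<noteq> {\<zero>\<^bsub>C\<^esub>}} = carrier G"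
    using G.generate_incl[of "carrier G"] generate.incl[of _ "carrier G" G] by auto
qed

text \<open>The claim reduces to an identity of coefficients in \<open>B\<close>, where the relation
  for \<sigma> rearranges the factors and the relation for \<alpha> produces the cocycle
  value.\<close>

lemma C_quasi_assoc:
  assumes g: "g \<in> carrier G" and h: "h \<in> carrier G" and k: "k \<in> carrier G"
    and x: "x \<in> carrier B" and y: "y \<in> carrier B" and z: "z \<in> carrier B"
  shows "(fmonom B x g \<otimes>\<^bsub>C\<^esub> fmonom B y h) \<otimes>\<^bsub>C\<^esub> fmonom B z k
    = \<phi> g h k \<odot>\<^bsub>C\<^esub> (fmonom B x g \<otimes>\<^bsub>C\<^esub> (fmonom B y h \<otimes>\<^bsub>C\<^esub> fmonom B z k))"
proof -
  have gh: "g \<otimes>\<^bsub>G\<^esub> h \<in> carrier G" and hk: "h \<otimes>\<^bsub>G\<^esub> k \<in> carrier G"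
    using g h k by auto
  have c: "\<phi> g h k \<in> carrier K"
    using cocycle g h k K.Units_closed unfolding cocycle_def by blast
  note closed = sigma_closed[OF g y] sigma_closed[OF h z] sigma_closed[OF gh z]
    sigma_closed[OF g sigma_closed[OF h z]] sigma_closed[OF g alpha_closed[OF h k]]
    alpha_closed[OF g h] alpha_closed[OF h k] alpha_closed[OF gh k] alpha_closed[OF g hk]
    BR.Units_inv_closed[OF alpha_Units[OF g h]] x y z
  \<comment> \<open>The conjugation relation, freed of its inverse, moves
    \<open>\<alpha> g h\<close> to the right, next to \<open>\<alpha> (gh) k\<close>.\<close>
  have swap: "\<alpha> g h \<otimes> \<sigma> (g \<otimes>\<^bsub>G\<^esub> h) z = \<sigma> g (\<sigma> h z) \<otimes> \<alpha> g h"
    using closed by (simp add: sigma_sigma[OF g h z] BR.m_assoc BR.Units_l_inv[OF alpha_Units[OF g h]])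
  have "x \<otimes> \<sigma> g y \<otimes> \<alpha> g h \<otimes> \<sigma> (g \<otimes>\<^bsub>G\<^esub> h) z \<otimes> \<alpha> (g \<otimes>\<^bsub>G\<^esub> h) k
      = x \<otimes> \<sigma> g y \<otimes> (\<alpha> g h \<otimes> \<sigma> (g \<otimes>\<^bsub>G\<^esub> h) z) \<otimes> \<alpha> (g \<otimes>\<^bsub>G\<^esub> h) k"
    using closed by (simp add: BR.m_assoc)
  also have "\<dots> = x \<otimes> \<sigma> g y \<otimes> \<sigma> g (\<sigma> h z) \<otimes> (\<alpha> g h \<otimes> \<alpha> (g \<otimes>\<^bsub>G\<^esub> h) k)"
    unfolding swap using closed by (simp add: BR.m_assoc)
  also have "\<dots> = \<phi> g h k \<odot> (x \<otimes> \<sigma> g (y \<otimes> \<sigma> h z \<otimes> \<alpha> h k) \<otimes> \<alpha> g (h \<otimes>\<^bsub>G\<^esub> k))"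
    unfolding alpha_alpha[OF g h k] using closed c g
    by (simp add: sigma_mult alg_smult_r BR.m_assoc)
  finally have eq: "x \<otimes> \<sigma> g y \<otimes> \<alpha> g h \<otimes> \<sigma> (g \<otimes>\<^bsub>G\<^esub> h) z \<otimes> \<alpha> (g \<otimes>\<^bsub>G\<^esub> h) k
    = \<phi> g h k \<odot> (x \<otimes> \<sigma> g (y \<otimes> \<sigma> h z \<otimes> \<alpha> h k) \<otimes> \<alpha> g (h \<otimes>\<^bsub>G\<^esub> k))" .
  have smult: "c \<odot>\<^bsub>C\<^esub> fmonom B t l = fmonom B (c \<odot> t) l" if "c \<in> carrier K" for c t l
    using that by (auto simp: C_simps fmonom_def)
  show ?thesis
    using closed c eq g h k gh hk by (simp add: fmonom_mult smult G.m_assoc)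
qed

lemma C_graded_quasialgebra: "graded_quasialgebra G K C Cg \<phi>"
  using C_quasi_assoc
  by (intro graded_quasialgebra.intro C_graded_algebra graded_quasialgebra_axioms.intro cocycle)
    (auto elim!: Cg_cases)

text \<open>An ansatz in degree g^-1 leaves one equation for the coefficient on each side. On the
  left the inverse of \<alpha>(g^-1,g) solves it directly, as \<sigma> acts on \<open>1\<close>
  only.\<close>

lemma fmonom_one_unit:
  assumes g: "g \<in> carrier G"
  shows "fmonom B \<one> g \<in> alg_units C"
proof -
  have ig: "inv\<^bsub>G\<^esub> g \<in> carrier G"
    using g by simp
  note U = alpha_Units[OF ig g] alpha_Units[OF g ig]
  have "fmonom B (inv (\<alpha> (inv\<^bsub>G\<^esub> g) g)) (inv\<^bsub>G\<^esub> g) \<otimes>\<^bsub>C\<^esub> fmonom B \<one> g = \<one>\<^bsub>C\<^esub>"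
    using g ig U BR.Units_inv_closed[OF U(1)]
    by (simp add: fmonom_mult sigma_one BR.Units_l_inv C_simps(2))
  \<comment> \<open>On the right \<sigma> acts on the unknown coefficient, so it is a preimage under
    \<open>\<sigma> g\<close> of the inverse of \<alpha>(g,g^-1).\<close>
  moreover obtain y where y: "y \<in> carrier B" "\<sigma> g y = inv (\<alpha> g (inv\<^bsub>G\<^esub> g))"
    using sigma_bij[OF g] BR.Units_inv_closed[OF U(2)] by (metis bij_betw_def imageE)
  then have "fmonom B \<one> g \<otimes>\<^bsub>C\<^esub> fmonom B y (inv\<^bsub>G\<^esub> g) = \<one>\<^bsub>C\<^esub>"
    using g ig U BR.Units_inv_closed[OF U(2)]
    by (simp add: fmonom_mult BR.Units_l_inv C_simps(2))
  ultimately show ?thesis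
    using g ig y(1) BR.Units_inv_closed[OF U(1)] unfolding alg_units_def
    by (blast intro: fmonom_closed BR.one_closed)
qed

lemma C_quasicrossed_product: "quasicrossed_product G K C Cg \<phi>"
proof (intro quasicrossed_product.intro C_graded_quasialgebra quasicrossed_product_axioms.intro)
  show "alg_units C \<inter> Cg g \<noteq> {}" if "g \<in> carrier G" for g
    using fmonom_one_unit[OF that] fmonom_in_Cg[OF BR.one_closed, of g] by auto
qed

section \<open>Identification of B with the neutral component and of the two systems\<close>

sublocale C: graded_quasialgebra G K C Cg \<phi>
  by (rule C_graded_quasialgebra)

abbreviation "\<iota> \<equiv> \<lambda>x. fmonom B x \<one>\<^bsub>G\<^esub>"

lemma iota_iso: "\<iota> \<in> algebra_iso K B (neutral_comp G C Cg)"
proof -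
  have "bij_betw \<iota> (carrier B) (Cg \<one>\<^bsub>G\<^esub>)"
    by (auto simp: bij_betw_def inj_on_def fmonom_eq_iff fmonom_comp_def)
  then show ?thesis
    using alpha_one[OF G.one_closed]
    by (auto simp: algebra_iso_def ring_iso_def ring_hom_def fmonom_in_Cg fmonom_mult sigma_neutral
        C_simps(2-4))
      (auto simp: fmonom_def)
qed

text \<open>No right inverse is computed: by \<open>eq_mult_right_inv\<close> both formulas reduce
  to products of monomials. The map \<open>inv_into (carrier B) \<iota>\<close> reads the
  coefficient back from an element of the neutral component, transporting \<sigma> there.\<close>

lemma C_corresponds:
  "corresponds_to_choice G C Cg (fmonom B \<one>) (\<lambda>g z. \<iota> (\<sigma> g (inv_into (carrier B) \<iota> z)))
    (\<lambda>g h. \<iota> (\<alpha> g h))"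
  unfolding corresponds_to_choice_def
proof (intro conjI ballI)
  show "unit_choice G C Cg (fmonom B \<one>)"
    unfolding unit_choice_def using fmonom_one_unit fmonom_in_Cg[OF BR.one_closed]
    by (auto simp: C_simps(2))
next
  fix g z assume g: "g \<in> carrier G" and z: "z \<in> Cg \<one>\<^bsub>G\<^esub>"
  obtain x where x: "x \<in> carrier B" "z = \<iota> x"
    using z by (rule Cg_cases)
  have "inv_into (carrier B) \<iota> z = x"
    using x by (auto simp: inj_on_def fmonom_eq_iff intro: inv_into_f_eq)
  moreover have "\<iota> (\<sigma> g x) = (fmonom B \<one> g \<otimes>\<^bsub>C\<^esub> z) \<otimes>\<^bsub>C\<^esub> right_inv C (fmonom B \<one> g)"
  proof (rule C.eq_mult_right_inv[OF g fmonom_one_unit[OF g] fmonom_in_Cg[OF BR.one_closed]])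
    show "\<iota> (\<sigma> g x) \<otimes>\<^bsub>C\<^esub> fmonom B \<one> g = fmonom B \<one> g \<otimes>\<^bsub>C\<^esub> z"
      using g x alpha_one[OF g] by (simp add: fmonom_mult sigma_closed sigma_neutral)
  qed (use g x in \<open>simp add: fmonom_in_Cg sigma_closed\<close>)
  ultimately show "\<iota> (\<sigma> g (inv_into (carrier B) \<iota> z))
      = (fmonom B \<one> g \<otimes>\<^bsub>C\<^esub> z) \<otimes>\<^bsub>C\<^esub> right_inv C (fmonom B \<one> g)"
    by simp
next
  fix g h assume g: "g \<in> carrier G" and h: "h \<in> carrier G"
  have gh: "g \<otimes>\<^bsub>G\<^esub> h \<in> carrier G"
    using g h by simp
  show "\<iota> (\<alpha> g h) = (fmonom B \<one> g \<otimes>\<^bsub>C\<^esub> fmonom B \<one> h) \<otimes>\<^bsub>C\<^esub> right_inv C (fmonom B \<one> (g \<otimes>\<^bsub>G\<^esub> h))"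
  proof (rule C.eq_mult_right_inv[OF gh fmonom_one_unit[OF gh] fmonom_in_Cg[OF BR.one_closed]])
    show "\<iota> (\<alpha> g h) \<otimes>\<^bsub>C\<^esub> fmonom B \<one> (g \<otimes>\<^bsub>G\<^esub> h) = fmonom B \<one> g \<otimes>\<^bsub>C\<^esub> fmonom B \<one> h"
      using g h gh alpha_one[OF gh] by (simp add: fmonom_mult sigma_one alpha_closed)
  qed (use g h in \<open>simp add: fmonom_in_Cg alpha_closed\<close>)
qed

lemma C_quasicrossed_system:
  "quasicrossed_system G K (neutral_comp G C Cg) \<phi>
    (\<lambda>g z. \<iota> (\<sigma> g (inv_into (carrier B) \<iota> z))) (\<lambda>g h. \<iota> (\<alpha> g h))"
  by (rule chosen_units.quasicrossed_system[OF chosen_units.intro[OF C_quasicrossed_product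
        chosen_units_axioms.intro[OF C_corresponds]]])

lemma C_monomial_mult:
  assumes "g \<in> carrier G" "h \<in> carrier G" "x \<in> carrier B" "y \<in> carrier B"
  shows "coeff_act B x (fmonom B \<one> g) \<otimes>\<^bsub>C\<^esub> coeff_act B y (fmonom B \<one> h)
    = coeff_act B (x \<otimes> \<sigma> g y \<otimes> \<alpha> g h) (fmonom B \<one> (g \<otimes>\<^bsub>G\<^esub> h))"
  using assms by (simp add: coeff_act_fmonom fmonom_mult sigma_closed alpha_closed)

lemma Cg_coeff_act: "Cg g = {coeff_act B x (fmonom B \<one> g) | x. x \<in> carrier B}"
  by (simp add: fmonom_comp_def coeff_act_fmonom cong: rev_conj_cong)

end

section \<open>The construction and its converse combined\<close>

theorem proposition4p9:
  fixes K :: "('k, 'm) ring_scheme"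
    and G :: "('g, 'l) monoid_scheme"
  assumes "algebraically_closed K" and "char_zero K" and "group G"
  shows
    "(\<forall>(A :: ('k, 'a) module) Ag \<phi> u \<sigma> \<alpha>.
        quasicrossed_product G K A Ag \<phi> \<and> corresponds_to_choice G A Ag u \<sigma> \<alpha> \<longrightarrow>
        (\<forall>g\<in>carrier G. \<forall>h\<in>carrier G.
           \<alpha> g h = \<phi> (inv\<^bsub>G\<^esub> (g \<otimes>\<^bsub>G\<^esub> h)) (g \<otimes>\<^bsub>G\<^esub> h) (inv\<^bsub>G\<^esub> (g \<otimes>\<^bsub>G\<^esub> h))
             \<odot>\<^bsub>A\<^esub> ((u g \<otimes>\<^bsub>A\<^esub> u h) \<otimes>\<^bsub>A\<^esub> left_inv A (u (g \<otimes>\<^bsub>G\<^esub> h)))) \<and>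
        (strongly_graded G A Ag \<and>
         (\<forall>g\<in>carrier G. Ag g = {x \<otimes>\<^bsub>A\<^esub> u g | x. x \<in> Ag \<one>\<^bsub>G\<^esub>} \<and>
                          Ag g = {u g \<otimes>\<^bsub>A\<^esub> x | x. x \<in> Ag \<one>\<^bsub>G\<^esub>})) \<and>
        quasicrossed_system G K (neutral_comp G A Ag) \<phi> \<sigma> \<alpha> \<and>
        (free_left_module (neutral_comp G A Ag) A (\<lambda>x y. x \<otimes>\<^bsub>A\<^esub> y) (carrier G) u \<and>
         free_right_module (neutral_comp G A Ag) A (\<lambda>y x. y \<otimes>\<^bsub>A\<^esub> x) (carrier G) u) \<and>
        (\<forall>g\<in>carrier G. \<forall>h\<in>carrier G. \<forall>x\<in>Ag \<one>\<^bsub>G\<^esub>. \<forall>y\<in>Ag \<one>\<^bsub>G\<^esub>.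
           (x \<otimes>\<^bsub>A\<^esub> u g) \<otimes>\<^bsub>A\<^esub> (y \<otimes>\<^bsub>A\<^esub> u h)
             = (x \<otimes>\<^bsub>A\<^esub> \<sigma> g y \<otimes>\<^bsub>A\<^esub> \<alpha> g h) \<otimes>\<^bsub>A\<^esub> u (g \<otimes>\<^bsub>G\<^esub> h))) \<and>
     (\<forall>(B :: ('k, 'b) module) \<phi> \<sigma> \<alpha>.
        quasicrossed_system G K B \<phi> \<sigma> \<alpha> \<longrightarrow>
        (let C = quasicrossed_algebra G B \<sigma> \<alpha>;
             Cg = fmonom_comp B;
             u = (\<lambda>g. fmonom B \<one>\<^bsub>B\<^esub> g);
             \<iota> = (\<lambda>x. fmonom B x \<one>\<^bsub>G\<^esub>);
             \<sigma>' = (\<lambda>g z. \<iota> (\<sigma> g (inv_into (carrier B) \<iota> z)));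
             \<alpha>' = (\<lambda>g h. \<iota> (\<alpha> g h))
         in free_left_module B C (coeff_act B) (carrier G) u \<and>
            (\<forall>g\<in>carrier G. \<forall>h\<in>carrier G. \<forall>x\<in>carrier B. \<forall>y\<in>carrier B.
               coeff_act B x (u g) \<otimes>\<^bsub>C\<^esub> coeff_act B y (u h)
                 = coeff_act B (x \<otimes>\<^bsub>B\<^esub> \<sigma> g y \<otimes>\<^bsub>B\<^esub> \<alpha> g h) (u (g \<otimes>\<^bsub>G\<^esub> h))) \<and>
            (\<forall>g\<in>carrier G. Cg g = {coeff_act B x (u g) | x. x \<in> carrier B}) \<and>
            graded_quasialgebra G K C Cg \<phi> \<and>
            quasicrossed_product G K C Cg \<phi> \<and>
            \<iota> \<in> algebra_iso K B (neutral_comp G C Cg) \<and>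
            quasicrossed_system G K (neutral_comp G C Cg) \<phi> \<sigma>' \<alpha>' \<and>
            corresponds_to_choice G C Cg u \<sigma>' \<alpha>'))"
proof ((rule conjI; intro allI; rule impI), goal_cases)
  case (1 A Ag \<phi> u \<sigma> \<alpha>)
  then interpret chosen_units G K A Ag \<phi> u \<sigma> \<alpha>
    by (intro chosen_units.intro chosen_units_axioms.intro) auto
  show ?case
    using alpha_left_inv strongly_graded Ag_eq quasicrossed_system free_left_module
      free_right_module monomial_mult by (intro conjI ballI)
next
  case (2 B \<phi> \<sigma> \<alpha>)
  then interpret crossed_construction G K B \<phi> \<sigma> \<alpha>
    by (rule crossed_construction.intro)
  show ?case
    unfolding Let_def
    by (intro conjI ballI C_free_left_module C_monomial_mult Cg_coeff_act C_graded_quasialgebra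
        C_quasicrossed_product iota_iso C_quasicrossed_system C_corresponds)
qed

end
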